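(* The bijection $\Psi:\mathcal B\to\mathcal{BZ}^{e}$, $\mathbf a\mapsto \mathbf M(\mathbf a)=(M_K(\mathbf a))_{K\in\mathcal M_n^\times}$, defined by $$M_K(\mathbf a)=-\sum_{j=1}^{l}\sum_{i=1}^{k_j-1}a_{i,k_j}+\min\Bigl\{\sum_{1\le p<q\le l}a_{c_{p,q},\,c_{p,q}+(q-p)}\ \Big|\ C=(c_{p,q})\text{ is a }K\text{-tableau}\Bigr\}\qquad (K=\{k_1<\dots<k_l\}),$$ is an isomorphism of crystals from $(\mathcal B,\mathrm{wt},\varepsilon_i^*,\varphi_i^*,\tilde e_i^*,\tilde f_i^* )$ to $(\mathcal{BZ}^e,\mathrm{wt},\varepsilon_i^*,\varphi_i^*,\tilde e_i^*,\tilde f_i^* )$. That is, $\Psi$ preserves $\mathrm{wt}$ and, for all $i\in I$, preserves $\varepsilon_i^*$ and $\varphi_i^*$ and commutes with $\tilde e_i^*$ and $\tilde f_i^*$ (where $\Psi(0)=0$).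
   Context: Let $n\ge1$, $I=\{1,\dots,n\}$, with simple roots $\alpha_i$ and simple coroots $h_i$ of $\mathfrak{sl}_{n+1}(\mathbb C)$, and let $[a,b]$ denote an integer interval (empty if $a>b$). **The set $\mathcal B$ and its $*$-crystal structure.** Let $\Pi=\{(i,j)\mid 1\le i<j\le n+1\}$ and let $\mathcal B$ be the set of families $\mathbf a=(a_{i,j})_{(i,j)\in\Pi}$ of non-negative integers. Put $\mathrm{wt}(\mathbf a)=-\sum_{i\in I}m_i\alpha_i$, $m_i=\sum_{k=1}^{i}\sum_{l=i+1}^{n+1}a_{k,l}$. For $i\in I$ and $i\le l\le n$ put $A_l^{*(i)}(\mathbf a)=\sum_{t=l+1}^{n+1}(a_{i,t}-a_{i+1,t+1})$ with $a_{i+1,n+2}=0$; $\varepsilon_i^*(\mathbf a)=\max_{i\le l\le n}A_l^{*(i)}(\mathbf a)$; $\varphi_i^*(\mathbf a)=\varepsilon_i^*(\mathbf a)+\langle h_i,\mathrm{wt}(\mathbf a)\rangle$. Let $l_e$ (resp. $l_f$) be the largest (resp. smallest) $l\in[i,n]$ with $A_l^{*(i)}(\mathbf a)=\varepsilon_i^*(\mathbf a)$. If $\varepsilon_i^*(\mathbf a)=0$ then $\tilde e_i^*\mathbf a=0$; otherwise $\tilde e_i^*\mathbf a$ is obtained from $\mathbf a$ by decreasing $a_{i,l_e+1}$ by $1$ and increasing $a_{i+1,l_e+1}$ by $1$. $\tilde f_i^*\mathbf a$ is obtained from $\mathbf a$ by increasing $a_{i,l_f+1}$ by $1$ and decreasing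 $a_{i+1,l_f+1}$ by $1$. (Changes to the non-existent entry $a_{i+1,i+1}$ are ignored.) **$e$-BZ data.** $\mathcal M_n$ is the set of all subsets of $[1,n+1]$ and $\mathcal M_n^\times=\mathcal M_n\setminus\{\emptyset,[1,n+1]\}$. An $e$-BZ datum is a family of integers $\mathbf M=(M_K)_{K\in\mathcal M_n^\times}$ such that, with the convention $M_\emptyset=M_{[1,n+1]}=0$ and writing $Kij=K\cup\{i,j\}$ etc.: (i) $M_{[1,i]}=0$ for all $i\in I$; (ii) $M_{Ki}+M_{Kj}\le M_{Kij}+M_K$ for all $i\ne j$ in $[1,n+1]$ and $K\in\mathcal M_n$ with $K\cap\{i,j\}=\emptyset$; (iii) $M_{Kik}+M_{Kj}=\min\{M_{Kij}+M_{Kk},\,M_{Kjk}+M_{Ki}\}$ for all $i<j<k$ in $[1,n+1]$ and $K\in\mathcal M_n$ with $K\cap\{i,j,k\}=\emptyset$. $\mathcal{BZ}^e$ is the set of $e$-BZ data. **$*$-crystal structure on $\mathcal{BZ}^e$ (after Kamnitzer).** For $\mathbf M\in\mathcal{BZ}^e$: $\mathrm{wt}(\mathbf M)=\sum_{i\in I}M_{[i+1,n+1]}\alpha_i$; $\varepsilon_i^*(\mathbf M)=-\bigl(M_{[i+1,n+1]}+M_{\{i\}\cup[i+2,n+1]}-M_{[i+2,n+1]}-M_{[i,n+1]}\bigr)\ge0$; $\varphi_i^*(\mathbf M)=\varepsilon_i^*(\mathbf M)+\langle h_i,\mathrm{wt}(\mathbf M)\rangle$. Let $\mathcal M_n^\times(i)^*=\{K\in\mathcal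 M_n^\times\mid i\notin K,\ i+1\in K\}$. It is known that there is a unique $e$-BZ datum $\tilde f_i^*\mathbf M$ with $(\tilde f_i^*\mathbf M)_{[i+1,n+1]}=M_{[i+1,n+1]}-1$ and $(\tilde f_i^*\mathbf M)_K=M_K$ for all $K\in\mathcal M_n^\times\setminus\mathcal M_n^\times(i)^*$; and, if $\varepsilon_i^*(\mathbf M)>0$, a unique $e$-BZ datum $\tilde e_i^*\mathbf M$ with $(\tilde e_i^*\mathbf M)_{[i+1,n+1]}=M_{[i+1,n+1]}+1$ and $(\tilde e_i^*\mathbf M)_K=M_K$ for all $K\in\mathcal M_n^\times\setminus\mathcal M_n^\times(i)^*$. If $\varepsilon_i^*(\mathbf M)=0$, $\tilde e_i^*\mathbf M=0$. **$K$-tableaux.** For $K=\{k_1<\dots<k_l\}\in\mathcal M_n^\times$, a $K$-tableau is an upper triangular array $C=(c_{p,q})_{1\le p\le q\le l}$ of integers with $c_{p,p}=k_p$, $c_{p,q}\le c_{p,q+1}$ and $c_{p,q}<c_{p+1,q}$ whenever both sides are defined. It is a known result of Berenstein–Fomin–Zelevinsky that $\mathbf M(\mathbf a)\in\mathcal{BZ}^e$ for every $\mathbf a\in\mathcal B$ and that $\Psi$ is a bijection. *)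

theory Defs
  imports Main
begin

section \<open>Crystal-type data and their isomorphisms\<close>

text \<open>
  The element \<open>0\<close> adjoined to a crystal is rendered as \<^const>\<open>None\<close>, and a map \<open>\<psi>\<close> is extended
  to the adjoined \<open>0\<close> by \<^const>\<open>map_option\<close>.
\<close>

record ('b, 'w) crystal_data =
  cr_set :: "'b set"
  cr_wt :: "'b \<Rightarrow> 'w"
  cr_eps :: "nat \<Rightarrow> 'b \<Rightarrow> int"
  cr_phi :: "nat \<Rightarrow> 'b \<Rightarrow> int"
  cr_e :: "nat \<Rightarrow> 'b \<Rightarrow> 'b option"
  cr_f :: "nat \<Rightarrow> 'b \<Rightarrow> 'b option"

definition cr_ops_closed :: "nat set \<Rightarrow> ('b, 'w) crystal_data \<Rightarrow> bool" where
  "cr_ops_closed I X \<longleftrightarrow>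
     (\<forall>i\<in>I. \<forall>x\<in>cr_set X.
        cr_e X i x \<in> insert None (Some ` cr_set X) \<and>
        cr_f X i x \<in> insert None (Some ` cr_set X))"

definition crystal_iso ::
  "nat set \<Rightarrow> ('b, 'w) crystal_data \<Rightarrow> ('c, 'w) crystal_data \<Rightarrow> ('b \<Rightarrow> 'c) \<Rightarrow> bool" where
  "crystal_iso I X Y \<psi> \<longleftrightarrow>
     cr_ops_closed I X \<and> cr_ops_closed I Y \<and>
     bij_betw \<psi> (cr_set X) (cr_set Y) \<and>
     (\<forall>x\<in>cr_set X. cr_wt Y (\<psi> x) = cr_wt X x) \<and>
     (\<forall>i\<in>I. \<forall>x\<in>cr_set X.
        cr_eps Y i (\<psi> x) = cr_eps X i x \<and>
        cr_phi Y i (\<psi> x) = cr_phi X i x \<and>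
        cr_e Y i (\<psi> x) = map_option \<psi> (cr_e X i x) \<and>
        cr_f Y i (\<psi> x) = map_option \<psi> (cr_f X i x))"

section \<open>Weights\<close>

text \<open>
  The root lattice of \<open>sl\<^bsub>n+1\<^esub>\<close> is realised inside \<open>\<int>\<^bsup>n+1\<^esup>\<close>, with coordinates \<open>1, \<dots>, n+1\<close>:
  the simple root \<open>\<alpha>\<^sub>i\<close> is the difference of the \<open>i\<close>-th and the \<open>(i+1)\<close>-st unit vector, and
  the coroot \<open>h\<^sub>i = E\<^bsub>i,i\<^esub> - E\<^bsub>i+1,i+1\<^esub>\<close> pairs with a weight \<open>\<mu>\<close> to \<open>\<mu>\<^sub>i - \<mu>\<^bsub>i+1\<^esub>\<close>.
\<close>

type_synonym weight = "nat \<Rightarrow> int"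

definition simple_root :: "nat \<Rightarrow> weight" where
  "simple_root i = (\<lambda>k. if k = i then 1 else if k = i + 1 then -1 else 0)"

definition coroot_pairing :: "nat \<Rightarrow> weight \<Rightarrow> int" where
  "coroot_pairing i \<mu> = \<mu> i - \<mu> (i + 1)"

definition root_comb :: "nat \<Rightarrow> (nat \<Rightarrow> int) \<Rightarrow> weight" where
  "root_comb n c = (\<lambda>k. \<Sum>i\<in>{1..n}. c i * simple_root i k)"

section \<open>The set \<open>\<B>\<close> and its \<open>*\<close>-crystal structure\<close>

text \<open>
  A family indexed by \<open>\<Pi>\<close> is a total function that vanishes off \<open>\<Pi>\<close>; in particular
  \<open>a\<^bsub>i+1,n+2\<^esub> = 0\<close>. Entries are of type \<^typ>\<open>int\<close> so that the decrements below never truncate.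
\<close>

type_synonym family = "nat \<Rightarrow> nat \<Rightarrow> int"

definition Pairs :: "nat \<Rightarrow> (nat \<times> nat) set" where
  "Pairs n = {(i, j). 1 \<le> i \<and> i < j \<and> j \<le> n + 1}"

definition B_set :: "nat \<Rightarrow> family set" where
  "B_set n = {a. (\<forall>i j. (i, j) \<in> Pairs n \<longrightarrow> a i j \<ge> 0) \<and>
                 (\<forall>i j. (i, j) \<notin> Pairs n \<longrightarrow> a i j = 0)}"

definition B_wt :: "nat \<Rightarrow> family \<Rightarrow> weight" where
  "B_wt n a = root_comb n (\<lambda>i. - (\<Sum>k = 1..i. \<Sum>l = i + 1..n + 1. a k l))"

definition A_star :: "nat \<Rightarrow> nat \<Rightarrow> nat \<Rightarrow> family \<Rightarrow> int" where
  "A_star n i l a = (\<Sum>t = l + 1..n + 1. a i t - a (i + 1) (t + 1))"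

definition B_eps :: "nat \<Rightarrow> nat \<Rightarrow> family \<Rightarrow> int" where
  "B_eps n i a = Max ((\<lambda>l. A_star n i l a) ` {i..n})"

definition B_phi :: "nat \<Rightarrow> nat \<Rightarrow> family \<Rightarrow> int" where
  "B_phi n i a = B_eps n i a + coroot_pairing i (B_wt n a)"

definition l_e :: "nat \<Rightarrow> nat \<Rightarrow> family \<Rightarrow> nat" where
  "l_e n i a = Max {l \<in> {i..n}. A_star n i l a = B_eps n i a}"

definition l_f :: "nat \<Rightarrow> nat \<Rightarrow> family \<Rightarrow> nat" where
  "l_f n i a = Min {l \<in> {i..n}. A_star n i l a = B_eps n i a}"

text \<open>
  Adding an integer to one entry; a change to an entry outside \<open>\<Pi>\<close>, such as
  \<open>a\<^bsub>i+1,i+1\<^esub>\<close>, has no effect.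
\<close>

definition add_entry :: "nat \<Rightarrow> nat \<times> nat \<Rightarrow> int \<Rightarrow> family \<Rightarrow> family" where
  "add_entry n ij d a =
     (\<lambda>p q. if (p, q) = ij \<and> (p, q) \<in> Pairs n then a p q + d else a p q)"

definition B_e :: "nat \<Rightarrow> nat \<Rightarrow> family \<Rightarrow> family option" where
  "B_e n i a =
     (if B_eps n i a = 0 then None
      else Some (add_entry n (i + 1, l_e n i a + 1) 1
                  (add_entry n (i, l_e n i a + 1) (- 1) a)))"

definition B_f :: "nat \<Rightarrow> nat \<Rightarrow> family \<Rightarrow> family option" where
  "B_f n i a =
     Some (add_entry n (i + 1, l_f n i a + 1) (- 1)
            (add_entry n (i, l_f n i a + 1) 1 a))"

definition B_crystal :: "nat \<Rightarrow> (family, weight) crystal_data" where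
  "B_crystal n =
     \<lparr>cr_set = B_set n, cr_wt = B_wt n, cr_eps = B_eps n, cr_phi = B_phi n,
      cr_e = B_e n, cr_f = B_f n\<rparr>"

section \<open>\<open>e\<close>-BZ data and their \<open>*\<close>-crystal structure\<close>

type_synonym bz = "nat set \<Rightarrow> int"

definition subsets_proper :: "nat \<Rightarrow> nat set set" where
  "subsets_proper n = Pow {1..n + 1} - {{}, {1..n + 1}}"

text \<open>
  A family indexed by the proper nonempty subsets of \<open>[1,n+1]\<close> is a total function that vanishes
  on all other sets, which includes the convention \<open>M\<^bsub>\<emptyset>\<^esub> = M\<^bsub>[1,n+1]\<^esub> = 0\<close>.
\<close>

definition BZ_set :: "nat \<Rightarrow> bz set" where
  "BZ_set n = {M.
     (\<forall>K. K \<notin> subsets_proper n \<longrightarrow> M K = 0) \<and>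
     (\<forall>i\<in>{1..n}. M {1..i} = 0) \<and>
     (\<forall>i\<in>{1..n + 1}. \<forall>j\<in>{1..n + 1}. \<forall>K. i \<noteq> j \<longrightarrow> K \<subseteq> {1..n + 1} \<longrightarrow> K \<inter> {i, j} = {} \<longrightarrow>
        M (K \<union> {i}) + M (K \<union> {j}) \<le> M (K \<union> {i, j}) + M K) \<and>
     (\<forall>i\<in>{1..n + 1}. \<forall>j\<in>{1..n + 1}. \<forall>k\<in>{1..n + 1}. \<forall>K.
        i < j \<longrightarrow> j < k \<longrightarrow> K \<subseteq> {1..n + 1} \<longrightarrow> K \<inter> {i, j, k} = {} \<longrightarrow>
        M (K \<union> {i, k}) + M (K \<union> {j}) =
          min (M (K \<union> {i, j}) + M (K \<union> {k})) (M (K \<union> {j, k}) + M (K \<union> {i})))}"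

definition BZ_wt :: "nat \<Rightarrow> bz \<Rightarrow> weight" where
  "BZ_wt n M = root_comb n (\<lambda>i. M {i + 1..n + 1})"

definition BZ_eps :: "nat \<Rightarrow> nat \<Rightarrow> bz \<Rightarrow> int" where
  "BZ_eps n i M =
     - (M {i + 1..n + 1} + M ({i} \<union> {i + 2..n + 1}) - M {i + 2..n + 1} - M {i..n + 1})"

definition BZ_phi :: "nat \<Rightarrow> nat \<Rightarrow> bz \<Rightarrow> int" where
  "BZ_phi n i M = BZ_eps n i M + coroot_pairing i (BZ_wt n M)"

definition subsets_star :: "nat \<Rightarrow> nat \<Rightarrow> nat set set" where
  "subsets_star n i = {K \<in> subsets_proper n. i \<notin> K \<and> i + 1 \<in> K}"

text \<open>
  The unique \<open>e\<close>-BZ datum whose \<open>[i+1,n+1]\<close>-component is that of \<open>M\<close> shifted by \<open>d\<close> and which agrees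
  with \<open>M\<close> outside \<^term>\<open>subsets_star n i\<close>.
\<close>

definition BZ_shift :: "nat \<Rightarrow> nat \<Rightarrow> int \<Rightarrow> bz \<Rightarrow> bz" where
  "BZ_shift n i d M =
     (THE M'. M' \<in> BZ_set n \<and> M' {i + 1..n + 1} = M {i + 1..n + 1} + d \<and>
        (\<forall>K \<in> subsets_proper n - subsets_star n i. M' K = M K))"

definition BZ_e :: "nat \<Rightarrow> nat \<Rightarrow> bz \<Rightarrow> bz option" where
  "BZ_e n i M = (if BZ_eps n i M = 0 then None else Some (BZ_shift n i 1 M))"

definition BZ_f :: "nat \<Rightarrow> nat \<Rightarrow> bz \<Rightarrow> bz option" where
  "BZ_f n i M = Some (BZ_shift n i (- 1) M)"

definition BZ_crystal :: "nat \<Rightarrow> (bz, weight) crystal_data" where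
  "BZ_crystal n =
     \<lparr>cr_set = BZ_set n, cr_wt = BZ_wt n, cr_eps = BZ_eps n, cr_phi = BZ_phi n,
      cr_e = BZ_e n, cr_f = BZ_f n\<rparr>"

section \<open>\<open>K\<close>-tableaux and the map \<open>\<Psi>\<close>\<close>

text \<open>The \<open>p\<close>-th smallest element \<open>k\<^sub>p\<close> of a finite set, counted from \<open>p = 1\<close>.\<close>

definition nth_elem :: "nat set \<Rightarrow> nat \<Rightarrow> nat" where
  "nth_elem K p = sorted_list_of_set K ! (p - 1)"

text \<open>
  Rows increase weakly from \<open>c\<^bsub>p,p\<^esub> = k\<^sub>p \<ge> 1\<close>, so all entries of an integer \<open>K\<close>-tableau are
  positive and natural-number entries lose nothing. The values of \<open>c\<close> off the triangle
  \<open>1 \<le> p \<le> q \<le> |K|\<close> are irrelevant and left arbitrary. On the triangle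
  \<open>k\<^sub>p \<le> c\<^bsub>p,q\<^esub> \<le> k\<^sub>q - (q - p)\<close>, and \<open>c\<^bsub>p,q\<^esub> = k\<^sub>p\<close> is a tableau; hence the
  minimum in \<open>Psi\<close> is over a finite nonempty set of values.
\<close>

definition is_tableau :: "nat set \<Rightarrow> (nat \<Rightarrow> nat \<Rightarrow> nat) \<Rightarrow> bool" where
  "is_tableau K c \<longleftrightarrow>
     (\<forall>p. 1 \<le> p \<and> p \<le> card K \<longrightarrow> c p p = nth_elem K p) \<and>
     (\<forall>p q. 1 \<le> p \<and> p \<le> q \<and> q + 1 \<le> card K \<longrightarrow> c p q \<le> c p (q + 1)) \<and>
     (\<forall>p q. 1 \<le> p \<and> p + 1 \<le> q \<and> q \<le> card K \<longrightarrow> c p q < c (p + 1) q)"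

definition tableau_sum :: "nat set \<Rightarrow> family \<Rightarrow> (nat \<Rightarrow> nat \<Rightarrow> nat) \<Rightarrow> int" where
  "tableau_sum K a c =
     (\<Sum>(p, q) \<in> {(p, q). 1 \<le> p \<and> p < q \<and> q \<le> card K}. a (c p q) (c p q + (q - p)))"

definition Psi :: "nat \<Rightarrow> family \<Rightarrow> bz" where
  "Psi n a =
     (\<lambda>K. if K \<in> subsets_proper n
          then - (\<Sum>j = 1..card K. \<Sum>i = 1..nth_elem K j - 1. a i (nth_elem K j))
               + Min {tableau_sum K a c | c. is_tableau K c}
          else 0)"

end

theory Submission
  imports Defs "Jordan_Normal_Form.Determinant"
begin

text \<open>
  Removing the diagonal of a \<open>K\<close>-tableau leaves a tableau on the set of entries \<open>c\<^bsub>p,p+1\<^esub>\<close>, which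
  interlaces \<open>K\<close>. The minors of a suitable matrix, in the columns \<open>K\<close> and the initial rows, obey the
  same recursion, so the generating function of the tableau weights is such a minor. Over polynomials
  with nonnegative coefficients the order turns the three-term Pluecker relation for minors into
  condition (iii). Condition (ii) follows from (iii) and \<open>a \<ge> 0\<close> by shrinking intervals.

  By (iii), an \<open>e\<close>-BZ datum is determined by its values on intervals, and
  \<open>a\<^bsub>i,j\<^esub> = M\<^bsub>[i,j]\<^esub> + M\<^bsub>[i+1,j-1]\<^esub> - M\<^bsub>[i,j-1]\<^esub> - M\<^bsub>[i+1,j]\<^esub>\<close>; this gives the bijection.

  For the crystal operators put
  \<open>E\<^sub>l = M\<^bsub>[i,l]\<^esub> + M\<^bsub>[i+2,l]\<^esub> - M\<^bsub>[i+1,l]\<^esub> - M\<^bsub>{i}\<union>[i+2,l]\<^esub>\<close>. Condition (iii) yields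
  \<open>E\<^bsub>l+1\<^esub> = a\<^bsub>i,l+1\<^esub> + max 0 (E\<^sub>l - a\<^bsub>i+1,l+1\<^esub>)\<close>, so that \<open>E\<^bsub>n+1\<^esub>\<close> is the maximum defining
  \<open>\<epsilon>\<^sub>i\<^sup>*\<close>. The values of \<open>M\<close> outside the sets \<open>K\<close> with \<open>i \<notin> K\<close> and \<open>i + 1 \<in> K\<close> are determined by the
  intervals and by the sets \<open>{i} \<union> [i+2,l]\<close>, hence by the \<open>E\<^sub>l\<close>, which are easily followed under
  the lowering operator.
\<close>

section \<open>Pluecker relation for initial minors\<close>

text \<open>Position \<open>s\<close> of the list is a matrix row and \<open>r\<close> a coordinate,
  so this is the minor of \<open>g\<close> on the first \<open>length cs\<close> coordinates. A list
  keeps order and repetition of columns visible.\<close>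

definition row_det :: "(nat \<Rightarrow> nat \<Rightarrow> 'a::comm_ring_1) \<Rightarrow> nat list \<Rightarrow> 'a" where
  "row_det g cs = det (mat (length cs) (length cs) (\<lambda>(s, r). g r (cs ! s)))"

lemma row_det_swap:
  "row_det g (xs @ a # b # ys) = - row_det g (xs @ b # a # ys)"
proof -
  let ?n = "length xs + 2 + length ys"
  let ?A = "\<lambda>cs. mat ?n ?n (\<lambda>(s, r). g r (cs ! s))"
  have "?A (xs @ a # b # ys) = swaprows (length xs) (Suc (length xs)) (?A (xs @ b # a # ys))"
    by (rule eq_matI) (auto simp: nth_append nth_Cons split: nat.split)
  then show ?thesis
    unfolding row_det_def
    by (subst det_swaprows[symmetric, where n = ?n and k = "length xs" and l = "Suc (length xs)"])
       auto
qed

lemma row_det_move: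
  "row_det g (xs @ a # ys) = (-1) ^ length ys * row_det g (xs @ ys @ [a])"
proof (induction ys arbitrary: xs)
  case (Cons b ys)
  have "row_det g (xs @ a # b # ys) = - row_det g ((xs @ [b]) @ a # ys)"
    by (simp add: row_det_swap[of g xs a b ys])
  then show ?case
    by (simp only: Cons.IH) simp
qed simp

lemma row_det_repeat:
  assumes "\<not> distinct cs"
  shows "row_det g cs = 0"
proof -
  obtain i j where "i < length cs" "j < length cs" "i \<noteq> j" "cs ! i = cs ! j"
    using assms by (auto simp: distinct_conv_nth)
  then show ?thesis
    unfolding row_det_def
    by (intro det_identical_rows[where i = i and j = j and n = "length cs"]) auto
qed

lemma row_det_expand_last:
  obtains C where "\<And>c. row_det g (ks @ [c]) = (\<Sum>r<Suc (length ks). g r c * C r)"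
proof
  fix c
  let ?n = "Suc (length ks)"
  let ?A = "\<lambda>c. mat ?n ?n (\<lambda>(s, r). g r ((ks @ [c]) ! s))"
  \<comment> \<open>The column \<open>c\<close> enters only the last row, so the cofactors along
    that row are those for \<open>c = 0\<close>.\<close>
  have "mat_delete (?A c) (length ks) r = mat_delete (?A 0) (length ks) r" if "r < ?n" for r
    using that by (intro eq_matI) (auto simp: mat_delete_def nth_append)
  then have "cofactor (?A c) (length ks) r = cofactor (?A 0) (length ks) r" if "r < ?n" for r
    using that by (simp add: cofactor_def)
  then show "row_det g (ks @ [c]) = (\<Sum>r<?n. g r c * cofactor (?A 0) (length ks) r)"
    unfolding row_det_def
    by (simp add: laplace_expansion_row[where i = "length ks" and n = ?n] nth_append)
qed

text \<open>Repeat the coordinate \<open>r\<close> as a last column and expand the vanishing determinant along it.\<close>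

lemma row_det_linear_relation:
  assumes "length cs = Suc m" "r < m"
  shows "(\<Sum>s<Suc m. (-1) ^ s * g r (cs ! s) * row_det g (take s cs @ drop (Suc s) cs)) = 0"
proof -
  let ?A = "mat (Suc m) (Suc m) (\<lambda>(s, q). if q = m then g r (cs ! s) else g q (cs ! s))"
  have "col ?A r = col ?A m"
    using assms by (intro eq_vecI) auto
  then have 0: "det ?A = 0"
    using assms by (intro det_identical_columns[where i = r and j = m and n = "Suc m"]) auto
  have "mat_delete ?A s m
      = mat m m (\<lambda>(t, q). g q ((take s cs @ drop (Suc s) cs) ! t))" if "s < Suc m" for s
    using that assms
    by (intro eq_matI) (auto simp: mat_delete_def nth_append min_def)
  then have "cofactor ?A s m = (-1) ^ (s + m) * row_det g (take s cs @ drop (Suc s) cs)"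
    if "s < Suc m" for s
    using that assms by (simp add: cofactor_def row_det_def min_def)
  then have "0 = (\<Sum>s<Suc m. g r (cs ! s) * ((-1) ^ (s + m) * row_det g (take s cs @ drop (Suc s) cs)))"
    using laplace_expansion_column[of ?A "Suc m" m] 0
    by (simp del: sum.lessThan_Suc)
  also have "\<dots> = (-1) ^ m *
      (\<Sum>s<Suc m. (-1) ^ s * g r (cs ! s) * row_det g (take s cs @ drop (Suc s) cs))"
    by (simp add: sum_distrib_left power_add mult_ac del: sum.lessThan_Suc)
  finally show ?thesis
    by (metis (no_types, lifting) left_minus_one_mult_self mult_zero_right)
qed

text \<open>By \<open>row_det_linear_relation\<close> the alternating sum of the columns
  \<open>ks @ [i, j, k]\<close>, each weighted by its complementary minor \<open>F s\<close>,
  vanishes coordinatewise. The map sending \<open>c\<close> to \<open>row_det g (ks @ [c])\<close>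
  is linear in these coordinates; it kills the columns from \<open>ks\<close>, and three terms are
  left.\<close>

lemma row_det_pluecker:
  "row_det g (ks @ [i, k]) * row_det g (ks @ [j])
   = row_det g (ks @ [i, j]) * row_det g (ks @ [k]) + row_det g (ks @ [j, k]) * row_det g (ks @ [i])"
proof -
  define m where "m = length ks"
  define cs where "cs = ks @ [i, j, k]"
  define F where "F s = row_det g (take s cs @ drop (Suc s) cs)" for s
  have len: "length cs = Suc (m + 2)"
    by (simp add: cs_def m_def)
  obtain C where C: "\<And>c. row_det g (ks @ [c]) = (\<Sum>r<Suc m. g r c * C r)"
    using row_det_expand_last unfolding m_def by blast
  have "(\<Sum>s<Suc (m + 2). (-1) ^ s * F s * row_det g (ks @ [cs ! s]))
      = (\<Sum>s<Suc (m + 2). \<Sum>r<Suc m. C r * ((-1) ^ s * g r (cs ! s) * F s))"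
    unfolding C sum_distrib_left by (intro sum.cong refl) (simp add: mult_ac)
  also have "\<dots> = (\<Sum>r<Suc m. \<Sum>s<Suc (m + 2). C r * ((-1) ^ s * g r (cs ! s) * F s))"
    by (rule sum.swap)
  also have "\<dots> = (\<Sum>r<Suc m. C r * (\<Sum>s<Suc (m + 2). (-1) ^ s * g r (cs ! s) * F s))"
    by (simp only: sum_distrib_left)
  also have "\<dots> = 0"
    unfolding F_def using len by (intro sum.neutral ballI) (simp only: row_det_linear_relation lessThan_iff, simp)
  finally have "(\<Sum>s<Suc (Suc (Suc m)). (-1) ^ s * F s * row_det g (ks @ [cs ! s])) = 0"
    by (simp del: sum.lessThan_Suc)
  moreover have "row_det g (ks @ [cs ! s]) = 0" if "s < m" for s
    using that by (intro row_det_repeat) (auto simp: cs_def m_def nth_append)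
  ultimately have "(-1) ^ m * (F m * row_det g (ks @ [i]) - F (Suc m) * row_det g (ks @ [j])
      + F (Suc (Suc m)) * row_det g (ks @ [k])) = 0"
    by (simp add: cs_def m_def nth_append algebra_simps)
  then have "F m * row_det g (ks @ [i]) - F (Suc m) * row_det g (ks @ [j])
      + F (Suc (Suc m)) * row_det g (ks @ [k]) = 0"
    by (metis (no_types, lifting) left_minus_one_mult_self mult_zero_right)
  moreover have "F m = row_det g (ks @ [j, k])" "F (Suc m) = row_det g (ks @ [i, k])"
    "F (Suc (Suc m)) = row_det g (ks @ [i, j])"
    by (simp_all add: F_def cs_def m_def)
  ultimately show ?thesis
    by (simp add: algebra_simps)
qed

section \<open>Sorted columns and signs\<close>

lemma sorted_list_of_set_eqI:
  fixes xs :: "nat list"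
  assumes "sorted_wrt (<) xs" "set xs = L"
  shows "sorted_list_of_set L = xs"
  using assms by (intro strict_sorted_equal sorted_list_of_set.strict_sorted_key_list_of_set) auto

lemma sorted_list_of_set_insert_split:
  fixes i :: nat
  assumes "finite K" "i \<notin> K"
  obtains p q where "sorted_list_of_set K = p @ q" "sorted_list_of_set (insert i K) = p @ i # q"
    "length q = card {x\<in>K. i < x}"
proof
  let ?p = "sorted_list_of_set {x\<in>K. x < i}" and ?q = "sorted_list_of_set {x\<in>K. i < x}"
  have "set ?p = {x\<in>K. x < i}" "set ?q = {x\<in>K. i < x}"
    using assms by auto
  moreover have "sorted_wrt (<) ?p" "sorted_wrt (<) ?q"
    by (rule sorted_list_of_set.strict_sorted_key_list_of_set)+
  moreover have "{x\<in>K. x < i} \<union> {x\<in>K. i < x} = K"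
    using assms by (auto, metis nat_neq_iff)
  ultimately show "sorted_list_of_set K = ?p @ ?q" "sorted_list_of_set (insert i K) = ?p @ i # ?q"
    by (intro sorted_list_of_set_eqI; force simp: sorted_wrt_append)+
  show "length ?q = card {x\<in>K. i < x}"
    by simp
qed

definition flag_minor :: "(nat \<Rightarrow> nat \<Rightarrow> 'a::comm_ring_1) \<Rightarrow> nat set \<Rightarrow> 'a" where
  "flag_minor g K = row_det g (sorted_list_of_set K)"

lemma flag_minor_insert:
  assumes "finite K" "i \<notin> K"
  shows "flag_minor g (insert i K)
    = (-1) ^ card {x\<in>K. i < x} * row_det g (sorted_list_of_set K @ [i])"
proof -
  obtain p q where "sorted_list_of_set K = p @ q" "sorted_list_of_set (insert i K) = p @ i # q"
    "length q = card {x\<in>K. i < x}"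
    using sorted_list_of_set_insert_split[OF assms] .
  then show ?thesis
    by (simp add: flag_minor_def row_det_move)
qed

text \<open>The element \<open>i\<close> passes \<open>j\<close> on its way to the end, and
  \<open>j\<close> then passes \<open>i\<close>; these two extra signs cancel.\<close>

lemma flag_minor_insert2:
  assumes "finite K" "i \<notin> K" "j \<notin> K" "i < j"
  shows "flag_minor g (insert i (insert j K))
    = (-1) ^ (card {x\<in>K. i < x} + card {x\<in>K. j < x}) * row_det g (sorted_list_of_set K @ [i, j])"
proof -
  obtain p q where pq: "sorted_list_of_set K = p @ q" "sorted_list_of_set (insert j K) = p @ j # q"
    "length q = card {x\<in>K. j < x}"
    using sorted_list_of_set_insert_split[OF assms(1,3)] .
  have "{x\<in>insert j K. i < x} = insert j {x\<in>K. i < x}"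
    using assms by auto
  then have "card {x\<in>insert j K. i < x} = Suc (card {x\<in>K. i < x})"
    using assms by simp
  moreover have "row_det g (p @ j # q @ [i]) = (-1) ^ Suc (length q) * row_det g (p @ q @ [i, j])"
    using row_det_move[of g p j "q @ [i]"] by simp
  ultimately show ?thesis
    using assms pq by (simp add: flag_minor_insert power_add)
qed

lemma flag_minor_pluecker:
  assumes "finite K" "i \<notin> K" "j \<notin> K" "k \<notin> K" "i < j" "j < k"
  shows "flag_minor g (insert i (insert k K)) * flag_minor g (insert j K)
    = flag_minor g (insert i (insert j K)) * flag_minor g (insert k K)
      + flag_minor g (insert j (insert k K)) * flag_minor g (insert i K)"
proof -
  \<comment> \<open>Each of the three products acquires the same sign
    \<open>s i * s j * s k\<close>.\<close>
  define s :: "nat \<Rightarrow> 'a" where "s x = (-1) ^ card {y\<in>K. x < y}" for x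
  define D where "D xs = row_det g (sorted_list_of_set K @ xs)" for xs
  have 1: "flag_minor g (insert x K) = s x * D [x]" if "x \<notin> K" for x
    using that assms by (simp add: flag_minor_insert s_def D_def)
  have 2: "flag_minor g (insert x (insert y K)) = s x * s y * D [x, y]"
    if "x \<notin> K" "y \<notin> K" "x < y" for x y
    using that assms by (simp add: flag_minor_insert2 s_def D_def power_add)
  have "D [i, k] * D [j] = D [i, j] * D [k] + D [j, k] * D [i]"
    unfolding D_def by (rule row_det_pluecker)
  then have "s i * s j * s k * (D [i, k] * D [j])
      = s i * s j * s k * (D [i, j] * D [k] + D [j, k] * D [i])"
    by simp
  then show ?thesis
    using assms by (simp add: 1 2 algebra_simps)
qed

section \<open>Tableau sums as orders of minors\<close>

text \<open>Compensates the fall of \<open>q - p\<close> by one when the diagonal of a tableau is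
  removed.\<close>

definition shift :: "(nat \<Rightarrow> nat \<Rightarrow> 'a) \<Rightarrow> nat \<Rightarrow> nat \<Rightarrow> 'a" where
  "shift x i j = x i (Suc j)"

text \<open>Unfolded, this is the sum over chains \<open>c > d_1 > ... > d_r\<close> of the products
  of the \<open>x d_s (d_s + s)\<close>.\<close>

fun path_coord :: "(nat \<Rightarrow> nat \<Rightarrow> 'a::comm_ring_1) \<Rightarrow> nat \<Rightarrow> nat \<Rightarrow> 'a" where
  "path_coord x 0 c = 1"
| "path_coord x (Suc r) c = (\<Sum>d<c. x d (Suc d) * path_coord (shift x) r d)"

definition interlacing :: "nat list \<Rightarrow> (nat \<Rightarrow> nat) set" where
  "interlacing ks = (\<Pi>\<^sub>E s\<in>{0..<length ks - 1}. {ks ! s..<ks ! Suc s})"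

text \<open>Subtracting from each row its predecessor clears the first column below its top entry
  \<open>1\<close> and turns the other entries into sums over
  \<open>ks ! s \<le> d < ks ! Suc s\<close>. Multilinearity in the rows then gives one summand for
  each interlacing \<open>\<phi>\<close>.\<close>

lemma row_det_path_coord:
  assumes "length ks = Suc l" "sorted_wrt (<) ks"
  shows "row_det (path_coord x) ks = (\<Sum>\<phi>\<in>interlacing ks.
    (\<Prod>s=0..<l. x (\<phi> s) (Suc (\<phi> s))) * row_det (path_coord (shift x)) (map \<phi> [0..<l]))"
proof -
  let ?n = "Suc l"
  define A where "A = mat ?n ?n (\<lambda>(s, r). path_coord x r (ks ! s))"
  define L :: "'a mat" where
    "L = mat ?n ?n (\<lambda>(s, t). if s = t then 1 else if s = Suc t then - 1 else 0)"
  define y where "y r d = x d (Suc d) * path_coord (shift x) r d" for r d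
  define B where "B = mat l l (\<lambda>(s, r). \<Sum>d = ks ! s..<ks ! Suc s. y r d)"
  have mono: "ks ! s < ks ! Suc s" if "s < l" for s
    using assms that by (simp add: sorted_wrt_iff_nth_less)
  have carr: "A \<in> carrier_mat ?n ?n" "L \<in> carrier_mat ?n ?n"
    by (auto simp: A_def L_def)
  have "det L = 1"
  proof -
    have "det L = prod_list (diag_mat L)"
      by (rule det_lower_triangular[OF _ carr(2)]) (auto simp: L_def)
    also have "diag_mat L = map (\<lambda>_. 1) [0..<?n]"
      by (auto simp: diag_mat_def L_def)
    finally show ?thesis
      by (simp add: map_replicate_const)
  qed
  then have "det A = det (L * A)"
    using det_mult[OF carr(2,1)] by simp
  have ent: "(L * A) $$ (s, r) = A $$ (s, r) - (if s = 0 then 0 else A $$ (s - 1, r))"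
    if "s < ?n" "r < ?n" for s r
  proof -
    have "(L * A) $$ (s, r) = (\<Sum>t=0..<?n. L $$ (s, t) * A $$ (t, r))"
      using that carr by (simp add: scalar_prod_def)
    also have "\<dots> = (\<Sum>t=0..<?n. (if t = s then A $$ (t, r) else 0)
        - (if s \<noteq> 0 \<and> t = s - 1 then A $$ (t, r) else 0))"
      using that by (intro sum.cong) (auto simp: L_def)
    also have "\<dots> = A $$ (s, r) - (if s = 0 then 0 else A $$ (s - 1, r))"
      using that by (auto simp: sum_subtractf)
    finally show ?thesis .
  qed
  have "det (L * A) = (\<Sum>s<?n. (L * A) $$ (s, 0) * cofactor (L * A) s 0)"
    using carr by (intro laplace_expansion_column) auto
  also have "\<dots> = (\<Sum>s<?n. if s = 0 then cofactor (L * A) 0 0 else 0)"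
  proof (intro sum.cong refl)
    fix s assume "s \<in> {..<?n}"
    moreover have "A $$ (s, 0) = 1" if "s < ?n" for s
      using that by (simp add: A_def)
    ultimately show "(L * A) $$ (s, 0) * cofactor (L * A) s 0
        = (if s = 0 then cofactor (L * A) 0 0 else 0)"
      by (simp add: ent del: index_mult_mat)
  qed
  also have "\<dots> = det (mat_delete (L * A) 0 0)"
    by (simp add: cofactor_def)
  also have "mat_delete (L * A) 0 0 = B"
  proof (rule eq_matI)
    fix s r assume sr: "s < dim_row B" "r < dim_col B"
    then have "mat_delete (L * A) 0 0 $$ (s, r) = (L * A) $$ (Suc s, Suc r)"
      using carr by (simp add: mat_delete_def B_def)
    also have "\<dots> = A $$ (Suc s, Suc r) - A $$ (s, Suc r)"
      using sr by (simp add: ent B_def del: index_mult_mat)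
    also have "\<dots> = (\<Sum>d<ks ! Suc s. y r d) - (\<Sum>d<ks ! s. y r d)"
      using sr by (simp add: B_def A_def y_def)
    also have "\<dots> = (\<Sum>d = ks ! s..<ks ! Suc s. y r d)"
      using sr mono[of s] by (simp add: sum_diff_nat_ivl lessThan_atLeast0 B_def)
    finally show "mat_delete (L * A) 0 0 $$ (s, r) = B $$ (s, r)"
      using sr by (simp add: B_def)
  qed (use carr in \<open>auto simp: B_def mat_delete_def\<close>)
  also have "det B = (\<Sum>p | p permutes {0..<l}. signof p *
      (\<Prod>s=0..<l. \<Sum>d = ks ! s..<ks ! Suc s. y (p s) d))"
    by (subst det_def'[of _ l])
       (auto simp: B_def intro!: sum.cong prod.cong arg_cong2[where f = "(*)"] dest: permutes_in_image)
  also have "\<dots> = (\<Sum>p | p permutes {0..<l}. \<Sum>\<phi>\<in>interlacing ks. signof p *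
      (\<Prod>s=0..<l. y (p s) (\<phi> s)))"
    using assms by (simp add: prod_sum_PiE sum_distrib_left interlacing_def)
  also have "\<dots> = (\<Sum>\<phi>\<in>interlacing ks. \<Sum>p | p permutes {0..<l}. signof p *
      (\<Prod>s=0..<l. y (p s) (\<phi> s)))"
    by (rule sum.swap)
  also have "\<dots> = (\<Sum>\<phi>\<in>interlacing ks. (\<Prod>s=0..<l. x (\<phi> s) (Suc (\<phi> s))) *
      row_det (path_coord (shift x)) (map \<phi> [0..<l]))"
  proof (intro sum.cong refl)
    fix \<phi>
    have "row_det (path_coord (shift x)) (map \<phi> [0..<l]) = (\<Sum>p | p permutes {0..<l}. signof p *
        (\<Prod>s=0..<l. path_coord (shift x) (p s) (\<phi> s)))"
      unfolding row_det_def
      by (subst det_def'[of _ l])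
         (auto intro!: sum.cong prod.cong arg_cong2[where f = "(*)"] dest: permutes_in_image)
    then show "(\<Sum>p | p permutes {0..<l}. signof p * (\<Prod>s=0..<l. y (p s) (\<phi> s))) =
        (\<Prod>s=0..<l. x (\<phi> s) (Suc (\<phi> s))) * row_det (path_coord (shift x)) (map \<phi> [0..<l])"
      by (simp add: sum_distrib_left y_def prod.distrib mult_ac)
  qed
  finally show ?thesis
    using \<open>det A = det (L * A)\<close> assms by (simp add: row_det_def A_def)
qed

section \<open>Orders of polynomials with nonnegative coefficients\<close>

definition has_order :: "int poly \<Rightarrow> nat \<Rightarrow> bool" where
  "has_order P m \<longleftrightarrow> (\<forall>k. 0 \<le> coeff P k) \<and> 0 < coeff P m \<and> (\<forall>k<m. coeff P k = 0)"

lemma has_order_unique: "has_order P a \<Longrightarrow> has_order P b \<Longrightarrow> a = b"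
  unfolding has_order_def by (metis less_irrefl linorder_neqE_nat)

lemma has_order_monom: "has_order (monom 1 m) m"
  by (simp add: has_order_def)

lemma has_order_one: "has_order 1 0"
  by (simp add: has_order_def)

text \<open>Nonnegative coefficients cannot cancel, so the lowest term survives even for
  \<open>a = b\<close>.\<close>

lemma has_order_add:
  "has_order P a \<Longrightarrow> has_order Q b \<Longrightarrow> has_order (P + Q) (min a b)"
  unfolding has_order_def
  by (cases a b rule: linorder_cases) (auto simp: min_def add_pos_nonneg add_nonneg_pos)

lemma has_order_mult:
  assumes "has_order P a" "has_order Q b"
  shows "has_order (P * Q) (a + b)"
proof -
  have nn: "0 \<le> coeff P i * coeff Q j" for i j
    using assms by (simp add: has_order_def)
  have "0 < coeff P a * coeff Q (a + b - a)"
    using assms by (simp add: has_order_def)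
  also have "\<dots> \<le> (\<Sum>i\<le>a + b. coeff P i * coeff Q (a + b - i))"
    by (rule member_le_sum) (use nn in auto)
  finally have "0 < coeff (P * Q) (a + b)"
    by (simp add: coeff_mult)
  moreover have "coeff (P * Q) k = 0" if "k < a + b" for k
  proof -
    have "coeff P i * coeff Q (k - i) = 0" if "i \<le> k" for i
    proof (cases "i < a")
      case False
      then have "k - i < b"
        using \<open>k < a + b\<close> that by auto
      then show ?thesis
        using assms by (simp add: has_order_def)
    qed (use assms in \<open>simp add: has_order_def\<close>)
    then show ?thesis
      unfolding coeff_mult by (intro sum.neutral) simp
  qed
  ultimately show ?thesis
    unfolding has_order_def by (auto simp: coeff_mult nn intro!: sum_nonneg)
qed

lemma has_order_prod:
  assumes "\<And>s. s \<in> A \<Longrightarrow> has_order (P s) (m s)"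
  shows "has_order (\<Prod>s\<in>A. P s) (\<Sum>s\<in>A. m s)"
  using assms
  by (induction A rule: infinite_finite_induct) (auto intro: has_order_one has_order_mult)

lemma has_order_sum:
  assumes "finite A" "A \<noteq> {}" "\<And>s. s \<in> A \<Longrightarrow> has_order (P s) (m s)"
  shows "has_order (\<Sum>s\<in>A. P s) (Min (m ` A))"
  using assms
  by (induction A rule: finite_ne_induct) (auto intro: has_order_add)

section \<open>Recursive structure of tableau sums\<close>

definition tableau_sums :: "nat set \<Rightarrow> family \<Rightarrow> int set" where
  "tableau_sums K a = {tableau_sum K a c | c. is_tableau K c}"

lemma nth_elem_set:
  assumes "sorted_wrt (<) ks"
  shows "nth_elem (set ks) p = ks ! (p - 1)" "card (set ks) = length ks"
proof -
  have "sorted_list_of_set (set ks) = ks"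
    using assms by (rule sorted_list_of_set_eqI) simp
  then show "nth_elem (set ks) p = ks ! (p - 1)" "card (set ks) = length ks"
    by (simp add: nth_elem_def, metis length_sorted_list_of_set)
qed

lemma interlacing_sorted:
  assumes "sorted_wrt (<) ks" "length ks = Suc l" "\<phi> \<in> interlacing ks"
  shows "sorted_wrt (<) (map \<phi> [0..<l])"
  unfolding sorted_wrt_iff_nth_less
proof (intro allI impI)
  fix s t assume st: "s < t" "t < length (map \<phi> [0..<l])"
  have \<phi>: "ks ! s \<le> \<phi> s" "\<phi> s < ks ! Suc s" if "s < l" for s
    using assms that by (auto simp: interlacing_def PiE_iff)
  have "\<phi> s < ks ! Suc s"
    using st by (intro \<phi>) auto
  also have "\<dots> \<le> ks ! t"
    using assms(1,2) st by (intro sorted_nth_mono strict_sorted_imp_sorted) auto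
  also have "\<dots> \<le> \<phi> t"
    using st by (intro \<phi>) auto
  finally show "map \<phi> [0..<l] ! s < map \<phi> [0..<l] ! t"
    using st by simp
qed

text \<open>The pairs with \<open>q = p + 1\<close> form the first superdiagonal, which is the
  diagonal of \<open>c'\<close>. All other pairs come from the smaller triangle by raising
  \<open>q\<close>, which \<open>shift\<close> absorbs.\<close>

lemma tableau_sum_remove_diagonal:
  assumes "card K = Suc l" "card K' = l" "\<And>p q. 1 \<le> p \<Longrightarrow> p \<le> q \<Longrightarrow> q \<le> l \<Longrightarrow> c' p q = c p (Suc q)"
  shows "tableau_sum K a c
    = (\<Sum>s=0..<l. a (c (Suc s) (Suc (Suc s))) (Suc (c (Suc s) (Suc (Suc s))))) + tableau_sum K' (shift a) c'"
proof -
  let ?f = "\<lambda>(p, q). a (c p q) (c p q + (q - p))"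
  let ?D = "(\<lambda>s. (Suc s, Suc (Suc s))) ` {0..<l}"
  let ?T = "{(p, q). 1 \<le> p \<and> p < q \<and> q \<le> l}"
  let ?U = "(\<lambda>(p, q). (p, Suc q)) ` ?T"
  have "{(p, q). 1 \<le> p \<and> p < q \<and> q \<le> Suc l} = ?D \<union> ?U"
  proof -
    have "(p, q) \<in> ?D \<union> ?U" if "1 \<le> p" "p < q" "q \<le> Suc l" for p q
    proof (cases "q = Suc p")
      case True
      with that show ?thesis
        by (intro UnI1 image_eqI[where x = "p - 1"]) auto
    next
      case False
      with that show ?thesis
        by (intro UnI2 image_eqI[where x = "(p, q - 1)"]) auto
    qed
    then show ?thesis
      by auto
  qed
  moreover have "finite ?T"
    by (rule finite_subset[of _ "{..l} \<times> {..l}"]) auto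
  ultimately have "tableau_sum K a c = sum ?f ?D + sum ?f ?U"
    using assms by (simp add: tableau_sum_def, subst sum.union_disjoint) auto
  also have "sum ?f ?D = (\<Sum>s=0..<l. a (c (Suc s) (Suc (Suc s))) (Suc (c (Suc s) (Suc (Suc s)))))"
    by (subst sum.reindex) (auto simp: inj_on_def)
  also have "sum ?f ?U = tableau_sum K' (shift a) c'"
    using assms unfolding tableau_sum_def
    by (subst sum.reindex) (auto simp: inj_on_def shift_def Suc_diff_le intro!: sum.cong)
  finally show ?thesis .
qed

text \<open>Row and column conditions place \<open>c p (p + 1)\<close> between consecutive elements
  of \<open>ks\<close>, so the superdiagonal interlaces \<open>ks\<close> and serves as diagonal of
  the remaining triangle. Conversely, every tableau on an interlacing set accepts \<open>ks\<close>
  as a new diagonal.\<close>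

lemma tableau_sums_rec:
  assumes "sorted_wrt (<) ks" "length ks = Suc l"
  shows "tableau_sums (set ks) a = (\<Union>\<phi>\<in>interlacing ks.
    (+) (\<Sum>s=0..<l. a (\<phi> s) (Suc (\<phi> s))) ` tableau_sums (set (map \<phi> [0..<l])) (shift a))"
    (is "?L = ?R")
proof (intro equalityI subsetI)
  note el = nth_elem_set[OF assms(1)]
  fix t assume "t \<in> ?L"
  then obtain c where c: "t = tableau_sum (set ks) a c" "is_tableau (set ks) c"
    by (auto simp: tableau_sums_def)
  then have diag: "c p p = ks ! (p - 1)" if "1 \<le> p" "p \<le> Suc l" for p
    using that assms by (simp add: is_tableau_def el)
  have row: "c p q \<le> c p (Suc q)" if "1 \<le> p" "p \<le> q" "q \<le> l" for p q
    using c(2) that assms by (simp add: is_tableau_def el)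
  have column: "c p q < c (Suc p) q" if "1 \<le> p" "p < q" "q \<le> Suc l" for p q
    using c(2) that assms by (simp add: is_tableau_def el)
  define \<phi> where "\<phi> = (\<lambda>s\<in>{0..<l}. c (Suc s) (Suc (Suc s)))"
  have \<phi>: "\<phi> \<in> interlacing ks"
    using row[of "Suc s" "Suc s" for s] column[of "Suc s" "Suc (Suc s)" for s] diag assms
    by (auto simp: interlacing_def \<phi>_def)
  note el' = nth_elem_set[OF interlacing_sorted[OF assms \<phi>]]
  let ?c' = "\<lambda>p q. c p (Suc q)"
  have "is_tableau (set (map \<phi> [0..<l])) ?c'"
    unfolding is_tableau_def el' using row column by (auto simp: \<phi>_def)
  moreover have "t = (\<Sum>s=0..<l. a (\<phi> s) (Suc (\<phi> s))) + tableau_sum (set (map \<phi> [0..<l])) (shift a) ?c'"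
    unfolding c(1)
    by (subst tableau_sum_remove_diagonal[where l = l and c' = ?c' and K' = "set (map \<phi> [0..<l])"])
       (use assms in \<open>auto simp only: el el' length_map length_upt diff_zero\<close>, auto simp: \<phi>_def)
  ultimately show "t \<in> ?R"
    using \<phi> by (auto simp: tableau_sums_def)
next
  note el = nth_elem_set[OF assms(1)]
  fix t assume "t \<in> ?R"
  then obtain \<phi> c' where \<phi>: "\<phi> \<in> interlacing ks"
    and c': "is_tableau (set (map \<phi> [0..<l])) c'"
    and t: "t = (\<Sum>s=0..<l. a (\<phi> s) (Suc (\<phi> s))) + tableau_sum (set (map \<phi> [0..<l])) (shift a) c'"
    by (auto simp: tableau_sums_def)
  note el' = nth_elem_set[OF interlacing_sorted[OF assms \<phi>]]
  have bounds: "ks ! s \<le> \<phi> s" "\<phi> s < ks ! Suc s" if "s < l" for s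
    using \<phi> assms that by (auto simp: interlacing_def PiE_iff)
  have diag: "c' p p = \<phi> (p - 1)" if "1 \<le> p" "p \<le> l" for p
    using that c' unfolding is_tableau_def el' by simp
  have row: "c' p q \<le> c' p (Suc q)" if "1 \<le> p" "p \<le> q" "q < l" for p q
    using that c' unfolding is_tableau_def el' by simp
  have column: "c' p q < c' (Suc p) q" if "1 \<le> p" "p < q" "q \<le> l" for p q
    using that c' unfolding is_tableau_def el' by simp
  define c where "c p q = (if p < q then c' p (q - 1) else ks ! (p - 1))" for p q
  have "is_tableau (set ks) c"
    unfolding is_tableau_def el
  proof (intro conjI allI impI)
    fix p q assume pq: "1 \<le> p \<and> p \<le> q \<and> q + 1 \<le> length ks"
    show "c p q \<le> c p (q + 1)"
      using pq row[of p "q - 1"] diag[of p] bounds[of "p - 1"] assms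
      by (cases "p = q") (auto simp: c_def)
  next
    fix p q assume pq: "1 \<le> p \<and> p + 1 \<le> q \<and> q \<le> length ks"
    show "c p q < c (p + 1) q"
      using pq column[of p "q - 1"] diag[of p] bounds[of "p - 1"] assms
      by (cases "p + 1 = q") (auto simp: c_def)
  qed (auto simp: c_def)
  moreover have "tableau_sum (set ks) a c = t"
    unfolding t
    by (subst tableau_sum_remove_diagonal[where l = l and c' = c' and K' = "set (map \<phi> [0..<l])"])
       (use assms diag in \<open>auto simp only: el el' length_map length_upt diff_zero\<close>, auto simp: c_def diag)
  ultimately show "t \<in> ?L"
    by (auto simp: tableau_sums_def)
qed

text \<open>\<open>row_det_path_coord\<close> and \<open>tableau_sums_rec\<close> have the same
  shape: sums and products of polynomials correspond to minima and sums of orders. The minimum is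
  stated as an attained lower bound, which passes easily through the union over
  \<open>\<phi>\<close>.\<close>

lemma tableau_sums_order:
  fixes a :: family
  assumes "sorted_wrt (<) ks" "\<And>i j. 0 \<le> a i j"
  shows "finite (tableau_sums (set ks) a)
    \<and> (\<exists>m. has_order (row_det (path_coord (\<lambda>i j. monom 1 (nat (a i j)))) ks) m
      \<and> int m \<in> tableau_sums (set ks) a \<and> (\<forall>t\<in>tableau_sums (set ks) a. int m \<le> t))"
  using assms
proof (induction "length ks" arbitrary: ks a)
  case 0
  have *: "{(p, q). 1 \<le> p \<and> p < q \<and> q \<le> card {}} = {}"
    by auto
  have "tableau_sum {} a c = 0" for c
    unfolding tableau_sum_def * by simp
  then have "tableau_sums {} a = {0}"
    by (auto simp: tableau_sums_def is_tableau_def)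
  then show ?case
    using 0 by (auto simp: row_det_def intro: has_order_one)
next
  case (Suc l)
  define S where "S \<phi> = tableau_sums (set (map \<phi> [0..<l])) (shift a)" for \<phi>
  define w where "w \<phi> = (\<Sum>s=0..<l. a (\<phi> s) (Suc (\<phi> s)))" for \<phi>
  define x :: "nat \<Rightarrow> nat \<Rightarrow> int poly" where "x = (\<lambda>i j. monom 1 (nat (a i j)))"
  define D where "D \<phi> = row_det (path_coord (shift x)) (map \<phi> [0..<l])" for \<phi>
  note len = Suc.hyps(2)[symmetric]
  have shift_x: "shift x = (\<lambda>i j. monom 1 (nat (shift a i j)))"
    by (intro ext) (simp add: shift_def x_def)
  have IH: "finite (S \<phi>) \<and> (\<exists>m. has_order (D \<phi>) m \<and> int m \<in> S \<phi> \<and> (\<forall>t\<in>S \<phi>. int m \<le> t))"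
    if "\<phi> \<in> interlacing ks" for \<phi>
    unfolding S_def D_def shift_x
    by (rule Suc.hyps(1)) (use interlacing_sorted[OF Suc.prems(1) len that] Suc.prems(2)
        in \<open>auto simp: shift_def\<close>)
  then obtain m where m: "\<And>\<phi>. \<phi> \<in> interlacing ks \<Longrightarrow>
      has_order (D \<phi>) (m \<phi>) \<and> int (m \<phi>) \<in> S \<phi> \<and> (\<forall>t\<in>S \<phi>. int (m \<phi>) \<le> t)"
    by metis
  have fin: "finite (interlacing ks)"
    unfolding interlacing_def by (intro finite_PiE) auto
  have nonempty: "interlacing ks \<noteq> {}"
    using Suc.prems(1) len
    by (auto simp: interlacing_def PiE_eq_empty_iff sorted_wrt_iff_nth_less)
  define M where "M \<phi> = (\<Sum>s=0..<l. nat (a (\<phi> s) (Suc (\<phi> s)))) + m \<phi>" for \<phi>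
  have M: "int (M \<phi>) = w \<phi> + int (m \<phi>)" for \<phi>
    using Suc.prems(2) by (simp add: M_def w_def)
  have "has_order ((\<Prod>s=0..<l. x (\<phi> s) (Suc (\<phi> s))) * D \<phi>) (M \<phi>)" if "\<phi> \<in> interlacing ks" for \<phi>
    unfolding M_def x_def using m[OF that] by (intro has_order_mult has_order_prod has_order_monom) auto
  then have "has_order (row_det (path_coord x) ks) (Min (M ` interlacing ks))"
    unfolding row_det_path_coord[OF len Suc.prems(1)] D_def
    by (intro has_order_sum fin nonempty)
  moreover have S: "tableau_sums (set ks) a = (\<Union>\<phi>\<in>interlacing ks. (+) (w \<phi>) ` S \<phi>)"
    unfolding w_def S_def by (rule tableau_sums_rec[OF Suc.prems(1) len])
  moreover have "Min (M ` interlacing ks) \<in> M ` interlacing ks"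
    using fin nonempty by (intro Min_in) auto
  then obtain \<phi> where "\<phi> \<in> interlacing ks" "Min (M ` interlacing ks) = M \<phi>"
    by auto
  then have "int (Min (M ` interlacing ks)) \<in> tableau_sums (set ks) a"
    using m by (auto simp: S M)
  moreover have "int (Min (M ` interlacing ks)) \<le> t" if t: "t \<in> tableau_sums (set ks) a" for t
  proof -
    obtain \<phi> u where \<phi>: "\<phi> \<in> interlacing ks" "u \<in> S \<phi>" "t = w \<phi> + u"
      using t by (auto simp: S)
    have "Min (M ` interlacing ks) \<le> M \<phi>"
      using fin \<phi> by (intro Min_le) auto
    then have "int (Min (M ` interlacing ks)) \<le> w \<phi> + int (m \<phi>)"
      using M[of \<phi>] by linarith
    also have "\<dots> \<le> t"
      using m \<phi> by auto
    finally show ?thesis .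
  qed
  moreover have "finite (tableau_sums (set ks) a)"
    unfolding S using fin IH by auto
  ultimately show ?case
    unfolding x_def by blast
qed

definition tableau_min :: "family \<Rightarrow> nat set \<Rightarrow> int" where
  "tableau_min a K = Min (tableau_sums K a)"

lemma finite_tableau_sums:
  assumes "finite K" "\<And>i j. 0 \<le> a i j"
  shows "finite (tableau_sums K a)"
  using tableau_sums_order[of "sorted_list_of_set K" a] assms
  by (simp add: sorted_list_of_set.strict_sorted_key_list_of_set)

lemma tableau_min_order:
  assumes "finite K" "\<And>i j. 0 \<le> a i j"
  obtains m where "tableau_min a K = int m"
    "has_order (flag_minor (path_coord (\<lambda>i j. monom 1 (nat (a i j)))) K) m"
proof -
  obtain m where "has_order (flag_minor (path_coord (\<lambda>i j. monom 1 (nat (a i j)))) K) m"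
    and m: "int m \<in> tableau_sums K a" "\<forall>t\<in>tableau_sums K a. int m \<le> t"
    using tableau_sums_order[of "sorted_list_of_set K" a] assms
    by (auto simp: sorted_list_of_set.strict_sorted_key_list_of_set flag_minor_def)
  moreover have "tableau_min a K = int m"
    unfolding tableau_min_def using m finite_tableau_sums[of K a] assms by (intro Min_eqI) auto
  ultimately show ?thesis
    using that by blast
qed

text \<open>Both sides of \<open>flag_minor_pluecker\<close> are the same polynomial; comparing
  their orders turns sums into minima and products into sums.\<close>

lemma tableau_min_tropical_pluecker:
  assumes "finite K" "i \<notin> K" "j \<notin> K" "k \<notin> K" "i < j" "j < k" "\<And>i j. 0 \<le> a i j"
  shows "tableau_min a (insert i (insert k K)) + tableau_min a (insert j K)
    = min (tableau_min a (insert i (insert j K)) + tableau_min a (insert k K))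
          (tableau_min a (insert j (insert k K)) + tableau_min a (insert i K))"
proof -
  let ?Z = "flag_minor (path_coord (\<lambda>i j. monom 1 (nat (a i j))))"
  have "\<forall>L. \<exists>m. finite L \<longrightarrow> tableau_min a L = int m \<and> has_order (?Z L) m"
    using tableau_min_order[where a = a] assms(7) by metis
  then obtain m where m: "\<And>L. finite L \<Longrightarrow> tableau_min a L = int (m L)"
    "\<And>L. finite L \<Longrightarrow> has_order (?Z L) (m L)"
    by metis
  have "has_order (?Z (insert i (insert k K)) * ?Z (insert j K))
      (m (insert i (insert k K)) + m (insert j K))"
    using assms by (intro has_order_mult m) auto
  moreover have "has_order (?Z (insert i (insert k K)) * ?Z (insert j K))
      (min (m (insert i (insert j K)) + m (insert k K)) (m (insert j (insert k K)) + m (insert i K)))"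
    unfolding flag_minor_pluecker[OF assms(1-6)]
    using assms by (intro has_order_add has_order_mult m) auto
  ultimately show ?thesis
    using has_order_unique assms(1) by (simp add: m(1) flip: of_nat_add of_nat_min)
qed

section \<open>Solutions of the tropical Pluecker relation\<close>

definition trop_pluecker :: "nat \<Rightarrow> bz \<Rightarrow> bool" where
  "trop_pluecker N M \<longleftrightarrow>
    (\<forall>K i j k. K \<subseteq> {1..N} \<longrightarrow> i \<notin> K \<longrightarrow> j \<notin> K \<longrightarrow> k \<notin> K \<longrightarrow> 1 \<le> i \<longrightarrow> i < j \<longrightarrow> j < k \<longrightarrow> k \<le> N \<longrightarrow>
      M (insert i (insert k K)) + M (insert j K)
      = min (M (insert i (insert j K)) + M (insert k K)) (M (insert j (insert k K)) + M (insert i K)))"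

lemma trop_plueckerD:
  assumes "trop_pluecker N M" "K \<subseteq> {1..N}" "i \<notin> K" "j \<notin> K" "k \<notin> K" "1 \<le> i" "i < j" "j < k" "k \<le> N"
  shows "M (insert i (insert k K)) + M (insert j K)
      = min (M (insert i (insert j K)) + M (insert k K)) (M (insert j (insert k K)) + M (insert i K))"
  using assms unfolding trop_pluecker_def by blast

section \<open>Defects and submodularity\<close>

text \<open>A mixed second difference: its nonnegativity is condition (ii), and over
  \<open>{i<..<j}\<close> it is the entry \<open>a i j\<close> of the corresponding family.\<close>

definition defect :: "bz \<Rightarrow> nat set \<Rightarrow> nat \<Rightarrow> nat \<Rightarrow> int" where
  "defect M K i j = M (insert i (insert j K)) + M K - M (insert i K) - M (insert j K)"

lemma defect_sym: "defect M K i j = defect M K j i"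
  by (simp add: defect_def insert_commute)

text \<open>This is (iii) with \<open>M K\<close> added and the values at \<open>insert i K\<close>,
  \<open>insert j K\<close> and \<open>insert k K\<close> subtracted on both sides.\<close>

lemma defect_gap:
  assumes "trop_pluecker N M" "K \<subseteq> {1..N}" "i \<notin> K" "j \<notin> K" "k \<notin> K" "1 \<le> i" "i < j" "j < k" "k \<le> N"
  shows "defect M K i k = min (defect M K i j) (defect M K j k)"
  using trop_plueckerD[OF assms] by (simp add: defect_def)

text \<open>The left side of (iii) is at most the first term of the minimum. Trading
  \<open>j\<close> for the larger \<open>k\<close> thus lengthens the pair without raising the
  defect; \<open>defect_widen_left\<close> uses the other term.\<close>

lemma defect_widen_right:
  assumes "trop_pluecker N M" "L \<subseteq> {1..N}" "i \<notin> L" "j \<notin> L" "k \<notin> L" "1 \<le> i" "i < j" "j < k" "k \<le> N"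
  shows "defect M (insert j L) i k \<le> defect M (insert k L) i j"
  using trop_plueckerD[OF assms] by (simp add: defect_def insert_commute)

lemma defect_widen_left:
  assumes "trop_pluecker N M" "L \<subseteq> {1..N}" "k \<notin> L" "i \<notin> L" "j \<notin> L" "1 \<le> k" "k < i" "i < j" "j \<le> N"
  shows "defect M (insert i L) k j \<le> defect M (insert k L) i j"
  using trop_plueckerD[OF assms] by (simp add: defect_def insert_commute)

lemma subset_drop_last: "K \<subseteq> {lo..hi} \<Longrightarrow> hi \<notin> K \<Longrightarrow> K \<subseteq> {lo..hi - 1}" for hi :: nat
  by (force simp: subset_iff le_less)

lemma subset_drop_first: "K \<subseteq> {lo..hi} \<Longrightarrow> lo \<notin> K \<Longrightarrow> K \<subseteq> {Suc lo..hi}"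
  by (force simp: subset_iff Suc_le_eq le_less)

text \<open>Widening makes \<open>i\<close> and \<open>j\<close> the extreme elements of \<open>insert i (insert j K)\<close>; any gap then
  splits the defect into defects over shorter ranges.\<close>

lemma defect_nonneg_range:
  assumes P: "trop_pluecker N M"
    and I: "\<And>i j. 1 \<le> i \<Longrightarrow> i < j \<Longrightarrow> j \<le> N \<Longrightarrow> 0 \<le> defect M {i<..<j} i j"
    and "K \<subseteq> {lo..hi}" "lo \<le> i" "i < j" "j \<le> hi" "i \<notin> K" "j \<notin> K" "1 \<le> lo" "hi \<le> N"
  shows "0 \<le> defect M K i j"
  using assms(3-)
proof (induction "hi - lo" arbitrary: lo hi K i j rule: less_induct)
  case less
  \<comment> \<open>\<open>ext\<close> treats pairs at both ends of the range, \<open>right\<close>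
    those whose upper end is \<open>hi\<close>; any other pair is first widened on the right or has
    a shorter range.\<close>
  have ext: "0 \<le> defect M L lo hi" if L: "L \<subseteq> {lo<..<hi}" and "lo < hi" for L
  proof (cases "L = {lo<..<hi}")
    case True
    then show ?thesis
      using I that less.prems by simp
  next
    case False
    then obtain g where g: "lo < g" "g < hi" "g \<notin> L"
      using L by (metis greaterThanLessThan_iff subsetI subset_antisym)
    have "L \<subseteq> {lo..hi - 1}" "L \<subseteq> {Suc lo..hi}" "lo \<notin> L" "hi \<notin> L" "L \<subseteq> {1..N}"
      using L less.prems by fastforce+
    then have "0 \<le> defect M L lo g" "0 \<le> defect M L g hi"
      using less.hyps[of "hi - 1" lo L lo g] less.hyps[of hi "Suc lo" L g hi] g less.prems
      by auto
    then show ?thesis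
      using defect_gap[OF P, of L lo g hi] g less.prems \<open>lo \<notin> L\<close> \<open>hi \<notin> L\<close> \<open>L \<subseteq> {1..N}\<close> by auto
  qed
  have right: "0 \<le> defect M L i hi" if L: "L \<subseteq> {lo..<hi}" "lo \<le> i" "i < hi" "i \<notin> L" for L i
  proof (cases "i = lo \<or> lo \<notin> L")
    case True
    show ?thesis
    proof (cases "i = lo")
      case True
      have "L \<subseteq> {lo<..<hi}"
        using L True by (auto simp: less_le)
      then show ?thesis
        using True L by (auto intro: ext)
    next
      case False
      with True have "lo \<notin> L"
        by simp
      then have "L \<subseteq> {Suc lo..hi}"
        using L by (intro subset_drop_first) (auto intro: less_imp_le)
      moreover have "hi \<notin> L"
        using L by auto
      ultimately have "L \<subseteq> {Suc lo..hi}" "hi \<notin> L"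
        by auto
      then show ?thesis
        using less.hyps[of hi "Suc lo" L i hi] L False less.prems by auto
    qed
  next
    case False
    define L' where "L' = L - {lo}"
    have L': "L = insert lo L'" "lo \<notin> L'" "i \<notin> L'" "hi \<notin> L'" "L' \<subseteq> {1..N}"
      using False L less.prems by (auto simp: L'_def)
    have "insert i L' \<subseteq> {lo<..<hi}"
      using L L' False by (force simp: less_le)
    then have "0 \<le> defect M (insert i L') lo hi"
      using L by (intro ext) auto
    also have "\<dots> \<le> defect M L i hi"
      unfolding L'(1) using L' L False less.prems by (intro defect_widen_left[OF P]) auto
    finally show ?thesis .
  qed
  show ?case
  proof (cases "j = hi \<or> hi \<notin> K")
    case True
    show ?thesis
    proof (cases "j = hi")
      case True
      have "K \<subseteq> {lo..<hi}"
        using less.prems True by (auto simp: less_le)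
      then show ?thesis
        unfolding True using less.prems True by (intro right) auto
    next
      case False
      with True have "K \<subseteq> {lo..hi - 1}"
        using less.prems by (intro subset_drop_last) auto
      then show ?thesis
        using less.hyps[of "hi - 1" lo K i j] False less.prems by auto
    qed
  next
    case False
    define L' where "L' = K - {hi}"
    have L': "K = insert hi L'" "hi \<notin> L'" "i \<notin> L'" "j \<notin> L'" "L' \<subseteq> {1..N}"
      using False less.prems by (auto simp: L'_def)
    have "insert j L' \<subseteq> {lo..<hi}"
      using less.prems L' False by (force simp: less_le)
    then have "0 \<le> defect M (insert j L') i hi"
      using less.prems L' by (intro right) auto
    also have "\<dots> \<le> defect M K i j"
      unfolding L'(1) using L' False less.prems by (intro defect_widen_right[OF P]) auto
    finally show ?thesis .
  qed
qed

lemma defect_nonneg: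
  assumes "trop_pluecker N M"
    and "\<And>i j. 1 \<le> i \<Longrightarrow> i < j \<Longrightarrow> j \<le> N \<Longrightarrow> 0 \<le> defect M {i<..<j} i j"
    and "K \<subseteq> {1..N}" "i \<noteq> j" "i \<in> {1..N} - K" "j \<in> {1..N} - K"
  shows "0 \<le> defect M K i j"
proof (cases "i < j")
  case True
  then show ?thesis
    using assms defect_nonneg_range[OF assms(1,2), of K 1 N i j] by auto
next
  case False
  then show ?thesis
    using assms defect_nonneg_range[OF assms(1,2), of K 1 N j i] by (auto simp: defect_sym[of M K i j])
qed

section \<open>Determination of solutions by few values\<close>

text \<open>On the left of (iii) the value at \<open>K\<close> is only accompanied by that at
  \<open>insert j L\<close>, so the other five values determine it.\<close>

lemma trop_pluecker_agree:
  assumes "trop_pluecker N M" "trop_pluecker N M'"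
    and "insert i (insert k L) = K" "L \<subseteq> {1..N}"
    and "i \<notin> L" "j \<notin> L" "k \<notin> L" "1 \<le> i" "i < j" "j < k" "k \<le> N"
    and "M (insert j L) = M' (insert j L)"
    and "M (insert i (insert j L)) = M' (insert i (insert j L))" "M (insert k L) = M' (insert k L)"
    and "M (insert j (insert k L)) = M' (insert j (insert k L))" "M (insert i L) = M' (insert i L)"
  shows "M K = M' K"
  using trop_plueckerD[OF assms(1,4-11)] trop_plueckerD[OF assms(2,4-11)] assms(3,12-) by simp

text \<open>Well-founded induction on the spread of a set. The hypothesis mentions an enclosing
  interval, so it applies to smaller sets without computing their extreme elements.\<close>

lemma range_induct [consumes 1, case_names empty range]:
  fixes K :: "nat set"
  assumes "finite K" "P {}"
    and range: "\<And>lo hi K. lo \<in> K \<Longrightarrow> hi \<in> K \<Longrightarrow> K \<subseteq> {lo..hi} \<Longrightarrow>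
       (\<And>K' lo' hi'. K' \<subseteq> {lo'..hi'} \<Longrightarrow> hi' - lo' < hi - lo \<Longrightarrow> P K') \<Longrightarrow> P K"
  shows "P K"
  using assms(1)
proof (induction "Max K - Min K" arbitrary: K rule: less_induct)
  case less
  show ?case
  proof (cases "K = {}")
    case False
    show ?thesis
    proof (rule range)
      show "Min K \<in> K" "Max K \<in> K" "K \<subseteq> {Min K..Max K}"
        using less.prems False by auto
      fix K' lo' hi' assume K': "K' \<subseteq> {lo'..hi'}" "hi' - lo' < Max K - Min K"
      have "finite K'"
        using K'(1) finite_subset by blast
      show "P K'"
      proof (cases "K' = {}")
        case False
        have "Min K' \<in> {lo'..hi'}" "Max K' \<in> {lo'..hi'}"
          using K'(1) False \<open>finite K'\<close> Min_in Max_in by blast+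
        then have "Max K' - Min K' \<le> hi' - lo'"
          by auto
        then show ?thesis
          using K'(2) \<open>finite K'\<close> by (intro less.hyps) auto
      qed (use assms in simp)
    qed
  qed (use assms in simp)
qed

lemma gap_exists:
  fixes lo :: nat
  assumes "lo \<in> K" "hi \<in> K" "K \<subseteq> {lo..hi}" "K \<noteq> {lo..hi}"
  obtains j where "lo < j" "j < hi" "j \<notin> K"
proof -
  obtain j where "j \<in> {lo..hi}" "j \<notin> K"
    using assms by blast
  moreover from this have "j \<noteq> lo" "j \<noteq> hi"
    using assms by auto
  ultimately show ?thesis
    by (intro that[of j]) auto
qed

text \<open>A set that is no interval has a gap \<open>j\<close> between its extremes
  \<open>lo\<close> and \<open>hi\<close>. The five other sets in (iii) at
  \<open>lo < j < hi\<close> each lack \<open>lo\<close> or \<open>hi\<close> and so have a shorter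
  range.\<close>

lemma trop_pluecker_unique:
  assumes P: "trop_pluecker N M" "trop_pluecker N M'"
    and I: "\<And>s t. 1 \<le> s \<Longrightarrow> t \<le> N \<Longrightarrow> M {s..t} = M' {s..t}"
    and "K \<subseteq> {1..N}"
  shows "M K = M' K"
proof -
  have "finite K"
    using assms(4) finite_subset by blast
  then show ?thesis
    using assms(4)
  proof (induction K rule: range_induct)
    case empty
    show ?case
      using I[of 1 0] by simp
  next
    case (range lo hi K)
    show ?case
    proof (cases "K = {lo..hi}")
      case True
      then show ?thesis
        using range.prems range.hyps I by auto
    next
      case False
      then obtain j where j: "lo < j" "j < hi" "j \<notin> K"
        using gap_exists[OF range.hyps] by blast
      define L where "L = K - {lo, hi}"
      have L: "insert lo (insert hi L) = K" "lo \<notin> L" "hi \<notin> L" "j \<notin> L" "L \<subseteq> {1..N}"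
        using range.hyps range.prems j by (auto simp: L_def)
      have "L \<subseteq> {Suc lo..hi - 1}"
        using range.hyps(3) L by (intro subset_drop_last subset_drop_first) auto
      then have sub: "L \<subseteq> {lo..hi - Suc 0}" "L \<subseteq> {Suc lo..hi}" "j \<le> hi - Suc 0" "lo \<le> hi - Suc 0"
        using j by force+
      have N: "1 \<le> lo" "hi \<le> N"
        using range.prems range.hyps by auto
      have IH: "M K' = M' K'" if "K' \<subseteq> {lo..hi - 1} \<or> K' \<subseteq> {Suc lo..hi}" for K'
        using that
      proof
        assume *: "K' \<subseteq> {lo..hi - 1}"
        with N show ?thesis
          using j by (intro range.IH[of _ lo "hi - 1"]) (auto simp: subset_iff)
      next
        assume *: "K' \<subseteq> {Suc lo..hi}"
        with N show ?thesis
          using j by (intro range.IH[of _ "Suc lo" hi]) (auto simp: subset_iff)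
      qed
      show ?thesis
        by (rule trop_pluecker_agree[OF P L(1), where j = j])
           (use L N j sub in \<open>simp_all add: IH\<close>)
    qed
  qed
qed

text \<open>The sets without \<open>i + 1\<close> are handled first, treating \<open>{1..N} - {i + 1}\<close> like an interval.\<close>

lemma trop_pluecker_unique_nonstar:
  assumes P: "trop_pluecker N M" "trop_pluecker N M'"
    and I: "\<And>s t. 1 \<le> s \<Longrightarrow> s \<noteq> i + 1 \<Longrightarrow> t \<le> N \<Longrightarrow> M {s..t} = M' {s..t}"
    and U: "\<And>t. i + 1 \<le> t \<Longrightarrow> t \<le> N \<Longrightarrow> M (insert i {i + 2..t}) = M' (insert i {i + 2..t})"
    and "1 \<le> i" "K \<subseteq> {1..N}" "i \<in> K \<or> i + 1 \<notin> K"
  shows "M K = M' K"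
proof -
  have no_succ: "M K = M' K" if "K \<subseteq> {1..N}" "i + 1 \<notin> K" for K
  proof -
    have "finite K"
      using that finite_subset by blast
    then show ?thesis
      using that
    proof (induction K rule: range_induct)
      case empty
      show ?case
        using I[of "i + 2" 0] by simp
    next
      case (range lo hi K)
      have N: "1 \<le> lo" "hi \<le> N"
        using range.prems range.hyps by auto
      have ends: "lo \<noteq> i + 1" "hi \<noteq> i + 1"
        using range.prems range.hyps by auto
      define L where "L = K - {lo, hi}"
      have IH: "M K' = M' K'"
        if "lo < hi" "K' \<subseteq> {lo..hi - 1} \<or> K' \<subseteq> {Suc lo..hi}" "i + 1 \<notin> K'" for K'
        using that(2)
      proof
        assume "K' \<subseteq> {lo..hi - 1}"
        with N that show ?thesis
          by (intro range.IH[of _ lo "hi - 1"]) (auto simp: subset_iff)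
      next
        assume "K' \<subseteq> {Suc lo..hi}"
        with N that show ?thesis
          by (intro range.IH[of _ "Suc lo" hi]) (auto simp: subset_iff)
      qed
      \<comment> \<open>Without a gap other than \<open>i + 1\<close>, the set is an interval or an
        interval with \<open>i + 1\<close> deleted; the latter splits by whether it starts at
        \<open>i\<close>.\<close>
      consider "K = {lo..hi}" | j where "lo < j" "j < hi" "j \<notin> K" "j \<noteq> i + 1"
        | "lo = i" "K = insert i {i + 2..hi}" "i + 2 \<le> hi"
        | "lo < i" "i + 1 < hi" "K = {lo..hi} - {i + 1}"
      proof (cases "K = {lo..hi} \<or> (\<exists>j. lo < j \<and> j < hi \<and> j \<notin> K \<and> j \<noteq> i + 1)")
        case True
        then show ?thesis
          using that by blast
      next
        case False
        then have K: "K \<noteq> {lo..hi}" "\<And>j. lo < j \<Longrightarrow> j < hi \<Longrightarrow> j \<noteq> i + 1 \<Longrightarrow> j \<in> K"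
          by auto
        have "K = {lo..hi} - {i + 1}"
        proof (intro equalityI subsetI)
          fix x assume "x \<in> {lo..hi} - {i + 1}"
          then show "x \<in> K"
            using K(2)[of x] range.hyps by (cases "x = lo \<or> x = hi") auto
        qed (use range.hyps range.prems in auto)
        moreover from this K(1) have "i + 1 \<in> {lo..hi}"
          by auto
        moreover have "{i..hi} - {i + 1} = insert i {i + 2..hi}" if "i + 1 \<le> hi"
          using that by auto
        ultimately show ?thesis
          using ends that by (cases "lo = i") auto
      qed
      then show ?case
      proof cases
        case 1
        then show ?thesis
          using range.prems range.hyps N ends I by auto
      next
        case (2 j)
        have L: "insert lo (insert hi L) = K" "lo \<notin> L" "hi \<notin> L" "j \<notin> L" "L \<subseteq> {1..N}" "i + 1 \<notin> L"
          using range.hyps range.prems 2 by (auto simp: L_def)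
        have "L \<subseteq> {Suc lo..hi - 1}"
          using range.hyps(3) L by (intro subset_drop_last subset_drop_first) auto
        then have "L \<subseteq> {lo..hi - Suc 0}" "L \<subseteq> {Suc lo..hi}" "j \<le> hi - Suc 0" "lo \<le> hi - Suc 0"
          using 2 by force+
        then show ?thesis
          using L(2-) N 2 ends by (intro trop_pluecker_agree[OF P L(1), where j = j]) (simp_all add: IH)
      next
        case 3
        then show ?thesis
          using U N by simp
      next
        \<comment> \<open>Now (iii) is used at the gap \<open>i + 1\<close> itself. The sets
          containing \<open>i + 1\<close> are intervals starting at \<open>lo\<close> or
          \<open>Suc lo\<close>, hence left of \<open>i + 1\<close>; the other two avoid
          \<open>i + 1\<close> and fall under the induction hypothesis.\<close>
        case 4
        have L: "insert lo (insert hi L) = K" "lo \<notin> L" "hi \<notin> L" "i + 1 \<notin> L" "L \<subseteq> {1..N}"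
          using range.hyps range.prems 4 by (auto simp: L_def)
        have 1: "insert (i + 1) L = {Suc lo..hi - 1}" "insert lo (insert (i + 1) L) = {lo..hi - 1}"
          "insert (i + 1) (insert hi L) = {Suc lo..hi}"
          using 4 by (auto simp: L_def)
        have "insert hi L \<subseteq> {Suc lo..hi}" "insert lo L \<subseteq> {lo..hi - 1}"
          using 4 by (auto simp: L_def)
        moreover have "lo < hi" "i + 1 \<notin> insert hi L" "i + 1 \<notin> insert lo L"
          using L(4) ends 4(1,2) by simp_all
        ultimately have 2: "M (insert hi L) = M' (insert hi L)" "M (insert lo L) = M' (insert lo L)"
          by (blast intro: IH)+
        have 3: "M {s..t} = M' {s..t}" if "s = lo \<or> s = Suc lo" "t = hi \<or> t = hi - 1" for s t
          using that N 4 by (intro I) auto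
        have "M (insert (i + 1) L) = M' (insert (i + 1) L)"
          unfolding 1(1) by (intro 3) auto
        moreover have "M (insert lo (insert (i + 1) L)) = M' (insert lo (insert (i + 1) L))"
          unfolding 1(2) by (intro 3) auto
        moreover have "M (insert (i + 1) (insert hi L)) = M' (insert (i + 1) (insert hi L))"
          unfolding 1(3) by (intro 3) auto
        ultimately show ?thesis
          using L(2-) N 4 2 by (intro trop_pluecker_agree[OF P L(1), where j = "i + 1"]) simp_all
      qed
    qed
  qed
  have "finite K"
    using \<open>K \<subseteq> {1..N}\<close> finite_subset by blast
  then show ?thesis
    using \<open>K \<subseteq> {1..N}\<close> \<open>i \<in> K \<or> i + 1 \<notin> K\<close>
  proof (induction K rule: range_induct)
    case empty
    then show ?case
      by (intro no_succ) auto
  next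
    case (range lo hi K)
    have N: "1 \<le> lo" "hi \<le> N"
      using range.prems range.hyps by auto
    have IH: "M K' = M' K'"
      if "lo < hi" "K' \<subseteq> {lo..hi - 1} \<or> K' \<subseteq> {Suc lo..hi}" "i \<in> K'" for K'
      using that(2)
    proof
      assume "K' \<subseteq> {lo..hi - 1}"
      with N that show ?thesis
        by (intro range.IH[of _ lo "hi - 1"]) (auto simp: subset_iff)
    next
      assume "K' \<subseteq> {Suc lo..hi}"
      with N that show ?thesis
        by (intro range.IH[of _ "Suc lo" hi]) (auto simp: subset_iff)
    qed
    show ?case
    proof (cases "i + 1 \<in> K")
      case False
      then show ?thesis
        using range.prems by (intro no_succ) auto
    next
      case True
      then have i: "i \<in> K" "i + 1 \<in> K"
        using range.prems by auto
      then have "lo \<le> i" "i + 1 \<le> hi"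
        using range.hyps by auto
      show ?thesis
      proof (cases "K = {lo..hi}")
        case True
        then show ?thesis
          using I N \<open>lo \<le> i\<close> by auto
      next
        case False
        then obtain j where j: "lo < j" "j < hi" "j \<notin> K"
          using gap_exists[OF range.hyps] by blast
        have jh: "j \<le> hi - Suc 0" "lo \<le> hi - Suc 0"
          using j by auto
        show ?thesis
        proof (cases "lo = i")
          case False
          define L where "L = K - {lo, hi}"
          have L: "insert lo (insert hi L) = K" "lo \<notin> L" "hi \<notin> L" "j \<notin> L" "L \<subseteq> {1..N}" "i \<in> L"
            using range.hyps range.prems j i False \<open>i + 1 \<le> hi\<close> by (auto simp: L_def)
          have "L \<subseteq> {Suc lo..hi - 1}"
            using range.hyps(3) L by (intro subset_drop_last subset_drop_first) auto
          then have "L \<subseteq> {lo..hi - Suc 0}" "L \<subseteq> {Suc lo..hi}"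
            using j by force+
          then show ?thesis
            using L(2-) N j jh by (intro trop_pluecker_agree[OF P L(1), where j = j]) (simp_all add: IH)
        next
          case True
          have "j \<noteq> i + 1"
            using j i by metis
          then have "i + 1 < j"
            using j True by auto
          \<comment> \<open>Here \<open>i\<close> is the smallest element and has to be kept, so
            (iii) is taken at \<open>i + 1 < j < hi\<close>: the other sets with
            \<open>i + 1\<close> lose \<open>hi\<close>, and those without it are covered by
            \<open>no_succ\<close>.\<close>
          define L where "L = K - {i + 1, hi}"
          have L: "insert (i + 1) (insert hi L) = K" "i + 1 \<notin> L" "hi \<notin> L" "j \<notin> L" "L \<subseteq> {1..N}" "i \<in> L"
            using range.hyps range.prems j i True \<open>i + 1 < j\<close> by (auto simp: L_def)
          have "L \<subseteq> {lo..hi - 1}"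
            using range.hyps(3) L by (intro subset_drop_last) auto
          then have 1: "M (insert (i + 1) (insert j L)) = M' (insert (i + 1) (insert j L))"
            "M (insert (i + 1) L) = M' (insert (i + 1) L)"
            using \<open>i + 1 < j\<close> j jh L True by (auto intro!: IH)
          have 2: "M (insert j L) = M' (insert j L)" "M (insert hi L) = M' (insert hi L)"
            "M (insert j (insert hi L)) = M' (insert j (insert hi L))"
            using \<open>i + 1 < j\<close> j N L by (auto intro!: no_succ)
          show ?thesis
            by (rule trop_pluecker_agree[OF P L(1), where j = j])
               (use L(2-) N j 1 2 \<open>i + 1 < j\<close> in auto)
        qed
      qed
    qed
  qed
qed

text \<open>In (iii) at \<open>i < i + 1 < t + 1\<close> over \<open>{i + 2..t}\<close>, only
  \<open>{i + 1..t}\<close> and \<open>{i + 1..t + 1}\<close> contain \<open>i + 1\<close> without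
  \<open>i\<close>, and the former occurs on the left only. Descending from the top, each value
  fixes the next.\<close>

lemma star_intervals_agree:
  assumes P: "trop_pluecker N M" "trop_pluecker N M'"
    and nonstar: "\<And>K. K \<subseteq> {1..N} \<Longrightarrow> i \<in> K \<or> i + 1 \<notin> K \<Longrightarrow> M K = M' K"
    and top: "M {i + 1..N} = M' {i + 1..N}"
    and "1 \<le> i" "i + 1 \<le> t" "t \<le> N"
  shows "M {i + 1..t} = M' {i + 1..t}"
  using assms(7,6)
proof (induction t rule: inc_induct)
  case base
  show ?case
    by (rule top)
next
  case (step t)
  let ?L = "{i + 2..t}"
  have eqs: "insert (i + 1) ?L = {i + 1..t}" "insert (i + 1) (insert (t + 1) ?L) = {i + 1..Suc t}"
    using step.prems by auto
  have sub: "?L \<subseteq> {1..N}" "i \<notin> ?L" "i + 1 \<notin> ?L" "t + 1 \<notin> ?L" "i < i + 1" "i + 1 < t + 1" "t + 1 \<le> N"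
    using step by auto
  have "M (insert i (insert (t + 1) ?L)) = M' (insert i (insert (t + 1) ?L))"
    "M (insert i (insert (i + 1) ?L)) = M' (insert i (insert (i + 1) ?L))"
    "M (insert (t + 1) ?L) = M' (insert (t + 1) ?L)" "M (insert i ?L) = M' (insert i ?L)"
    using sub assms(5) step by (auto intro!: nonstar)
  moreover have "M (insert (i + 1) (insert (t + 1) ?L)) = M' (insert (i + 1) (insert (t + 1) ?L))"
    unfolding eqs using step by simp
  ultimately have "M (insert (i + 1) ?L) = M' (insert (i + 1) ?L)"
    using trop_plueckerD[OF P(1) sub(1-4) assms(5) sub(5-)] trop_plueckerD[OF P(2) sub(1-4) assms(5) sub(5-)]
    by simp
  then show ?case
    unfolding eqs .
qed

section \<open>The bijection\<close>

text \<open>Given (iii), \<open>defect_nonneg\<close> recovers all of (ii) from the pairs whose gap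
  is filled by \<open>K\<close>.\<close>

lemma BZ_set_iff:
  "M \<in> BZ_set n \<longleftrightarrow> (\<forall>K. K \<notin> subsets_proper n \<longrightarrow> M K = 0) \<and> (\<forall>i\<in>{1..n}. M {1..i} = 0)
    \<and> trop_pluecker (n + 1) M
    \<and> (\<forall>i j. 1 \<le> i \<longrightarrow> i < j \<longrightarrow> j \<le> n + 1 \<longrightarrow> 0 \<le> defect M {i<..<j} i j)"
    (is "_ \<longleftrightarrow> ?R")
proof
  assume "M \<in> BZ_set n"
  note M = this[unfolded BZ_set_def mem_Collect_eq]
  have "trop_pluecker (n + 1) M"
    unfolding trop_pluecker_def
  proof (intro allI impI)
    fix K i j k
    assume "K \<subseteq> {1..n + 1}" "i \<notin> K" "j \<notin> K" "k \<notin> K" "1 \<le> i" "i < j" "j < k" "k \<le> n + 1"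
    moreover from this have "i \<in> {1..n + 1}" "j \<in> {1..n + 1}" "k \<in> {1..n + 1}" "K \<inter> {i, j, k} = {}"
      by auto
    ultimately have "M (K \<union> {i, k}) + M (K \<union> {j}) =
        min (M (K \<union> {i, j}) + M (K \<union> {k})) (M (K \<union> {j, k}) + M (K \<union> {i}))"
      by (intro M[THEN conjunct2, THEN conjunct2, THEN conjunct2, rule_format])
    then show "M (insert i (insert k K)) + M (insert j K)
      = min (M (insert i (insert j K)) + M (insert k K)) (M (insert j (insert k K)) + M (insert i K))"
      by simp
  qed
  moreover have "0 \<le> defect M {i<..<j} i j" if "1 \<le> i" "i < j" "j \<le> n + 1" for i j
  proof -
    have "i \<in> {1..n + 1}" "j \<in> {1..n + 1}" "i \<noteq> j" "{i<..<j} \<subseteq> {1..n + 1}" "{i<..<j} \<inter> {i, j} = {}"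
      using that by auto
    then have "M ({i<..<j} \<union> {i}) + M ({i<..<j} \<union> {j}) \<le> M ({i<..<j} \<union> {i, j}) + M {i<..<j}"
      by (intro M[THEN conjunct2, THEN conjunct2, THEN conjunct1, rule_format])
    then show ?thesis
      by (simp add: defect_def)
  qed
  ultimately show ?R
    using M[THEN conjunct1] M[THEN conjunct2, THEN conjunct1] by blast
next
  assume R: ?R
  have submodular: "M (K \<union> {i}) + M (K \<union> {j}) \<le> M (K \<union> {i, j}) + M K"
    if "i \<in> {1..n + 1}" "j \<in> {1..n + 1}" "i \<noteq> j" "K \<subseteq> {1..n + 1}" "K \<inter> {i, j} = {}" for i j K
    using defect_nonneg[of "n + 1" M K i j] R that by (simp add: defect_def)
  have pluecker: "M (K \<union> {i, k}) + M (K \<union> {j}) =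
        min (M (K \<union> {i, j}) + M (K \<union> {k})) (M (K \<union> {j, k}) + M (K \<union> {i}))"
    if "i \<in> {1..n + 1}" "j \<in> {1..n + 1}" "k \<in> {1..n + 1}" "i < j" "j < k"
      "K \<subseteq> {1..n + 1}" "K \<inter> {i, j, k} = {}" for i j k K
    using trop_plueckerD[of "n + 1" M K i j k] R that by simp
  show "M \<in> BZ_set n"
    unfolding BZ_set_def mem_Collect_eq
  proof (intro conjI)
    show "\<forall>K. K \<notin> subsets_proper n \<longrightarrow> M K = 0" "\<forall>i\<in>{1..n}. M {1..i} = 0"
      using R by blast+
  qed (intro ballI allI impI submodular pluecker; assumption)+
qed

lemma BZ_set_full: "M \<in> BZ_set n \<Longrightarrow> M {} = 0 \<and> M {1..n + 1} = 0"
  by (simp add: BZ_set_iff subsets_proper_def)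

lemma BZ_set_initial: "M \<in> BZ_set n \<Longrightarrow> i \<le> n + 1 \<Longrightarrow> M {1..i} = 0"
  using BZ_set_full[of M n] by (cases "i = 0 \<or> i = n + 1") (auto simp: BZ_set_iff)

lemma BZ_set_eqI:
  assumes "M \<in> BZ_set n" "M' \<in> BZ_set n"
    and "\<And>s t. 1 \<le> s \<Longrightarrow> t \<le> n + 1 \<Longrightarrow> M {s..t} = M' {s..t}"
  shows "M = M'"
proof
  fix K
  show "M K = M' K"
  proof (cases "K \<subseteq> {1..n + 1}")
    case True
    then show ?thesis
      using assms(1,2)[unfolded BZ_set_iff] assms(3)
      by (intro trop_pluecker_unique[of "n + 1" M M' K]) simp_all
  next
    case False
    then have "K \<notin> subsets_proper n"
      by (auto simp: subsets_proper_def)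
    then show ?thesis
      using assms by (simp add: BZ_set_iff)
  qed
qed

lemma defect_interval:
  assumes "i < j"
  shows "defect M {i<..<j} i j = M {i..j} + M {i + 1..j - 1} - M {i..j - 1} - M {i + 1..j}"
proof -
  have "insert i (insert j {i<..<j}) = {i..j}" "insert i {i<..<j} = {i..j - 1}"
    "insert j {i<..<j} = {i + 1..j}" "{i<..<j} = {i + 1..j - 1}"
    using assms by auto
  then show ?thesis
    by (simp only: defect_def)
qed

section \<open>Values of \<open>Psi\<close> on intervals\<close>

lemma B_set_nonneg: "a \<in> B_set n \<Longrightarrow> 0 \<le> a i j"
  unfolding B_set_def by (cases "(i, j) \<in> Pairs n") auto

lemma tableau_bounds:
  assumes "is_tableau K c" "1 \<le> p" "p \<le> q" "q \<le> card K"
  shows "nth_elem K p \<le> c p q" "c p q + (q - p) \<le> nth_elem K q"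
proof -
  show "nth_elem K p \<le> c p q"
    using assms(3,4)
  proof (induction q rule: dec_induct)
    case base
    then show ?case
      using assms by (simp add: is_tableau_def)
  next
    case (step q)
    then have "c p q \<le> c p (q + 1)"
      using assms unfolding is_tableau_def by simp
    then show ?case
      using step by simp
  qed
  show "c p q + (q - p) \<le> nth_elem K q"
    using assms(3,2)
  proof (induction p rule: inc_induct)
    case base
    then show ?case
      using assms by (simp add: is_tableau_def)
  next
    case (step p)
    then have "c p q < c (p + 1) q"
      using assms unfolding is_tableau_def by simp
    then show ?case
      using step by simp
  qed
qed

text \<open>For an interval the two bounds of \<open>tableau_bounds\<close> meet, so every tableau
  is constant along its rows and the minimum runs over one value.\<close>

lemma tableau_min_interval:
  assumes "1 \<le> s"
  shows "tableau_min a {s..t} = (\<Sum>j=s..t. \<Sum>i=s..<j. a i j)"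
proof -
  let ?K = "{s..t}"
  let ?T = "{(p, q). 1 \<le> p \<and> p < q \<and> q \<le> card ?K}"
  have el: "nth_elem ?K p = s + p - 1" if "1 \<le> p" "p \<le> card ?K" for p
    using that by (simp add: nth_elem_def atLeastLessThanSuc_atLeastAtMost[symmetric] del: upt_Suc)
  have "tableau_sum ?K a c = (\<Sum>j=s..t. \<Sum>i=s..<j. a i j)" if c: "is_tableau ?K c" for c
  proof -
    have "c p q = s + p - 1 \<and> c p q + (q - p) = s + q - 1" if "(p, q) \<in> ?T" for p q
      using tableau_bounds[OF c, of p q] that el[of p] el[of q] by auto
    then have "tableau_sum ?K a c = (\<Sum>(p, q)\<in>?T. a (s + p - 1) (s + q - 1))"
      unfolding tableau_sum_def by (intro sum.cong) auto
    also have "\<dots> = (\<Sum>(j, i)\<in>Sigma {s..t} (\<lambda>j. {s..<j}). a i j)"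
      by (rule sum.reindex_bij_witness[where i = "\<lambda>(j, i). (i + 1 - s, j + 1 - s)"
            and j = "\<lambda>(p, q). (s + q - 1, s + p - 1)"]) (use assms in auto)
    also have "\<dots> = (\<Sum>j=s..t. \<Sum>i=s..<j. a i j)"
      by (rule sum.Sigma[symmetric]) auto
    finally show ?thesis .
  qed
  moreover have "is_tableau ?K (\<lambda>p q. nth_elem ?K p)"
    using el assms unfolding is_tableau_def by auto
  ultimately have "tableau_sums ?K a = {\<Sum>j=s..t. \<Sum>i=s..<j. a i j}"
    unfolding tableau_sums_def by (auto intro!: exI[of _ "\<lambda>p q. nth_elem ?K p"])
  then show ?thesis
    by (simp add: tableau_min_def)
qed

lemma sum_nth_elem:
  assumes "finite K"
  shows "(\<Sum>j=1..card K. f (nth_elem K j)) = sum f K"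
proof -
  let ?ks = "sorted_list_of_set K"
  have "sum f K = sum_list (map f ?ks)"
    using assms by (simp add: sum_list_distinct_conv_sum_set)
  also have "\<dots> = (\<Sum>j=0..<card K. f (?ks ! j))"
    by (simp add: sum_list_sum_nth)
  also have "\<dots> = (\<Sum>j=1..card K. f (nth_elem K j))"
    by (rule sum.reindex_bij_witness[where i = "\<lambda>j. j - 1" and j = Suc]) (auto simp: nth_elem_def)
  finally show ?thesis ..
qed

text \<open>The tableau contribution cancels the terms with \<open>s \<le> i\<close>.\<close>

lemma Psi_interval_aux:
  assumes "1 \<le> s"
  shows "tableau_min a {s..t} - (\<Sum>j=s..t. \<Sum>i=1..j - 1. a i j) = - (\<Sum>j=s..t. \<Sum>i=1..<s. a i j)"
proof -
  have "(\<Sum>i=1..j - 1. a i j) = (\<Sum>i=1..<s. a i j) + (\<Sum>i=s..<j. a i j)" if "j \<in> {s..t}" for j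
  proof -
    have "{1..j - 1} = {1..<s} \<union> {s..<j}"
      using that assms by auto
    then show ?thesis
      by (simp only:, subst sum.union_disjoint) auto
  qed
  then have "(\<Sum>j=s..t. \<Sum>i=1..j - 1. a i j)
      = (\<Sum>j=s..t. (\<Sum>i=1..<s. a i j) + (\<Sum>i=s..<j. a i j))"
    by (intro sum.cong) auto
  then show ?thesis
    using assms by (simp add: tableau_min_interval sum.distrib)
qed

text \<open>At the empty and the full set \<open>Psi\<close> is \<open>0\<close> by convention. Both
  have the form \<open>{1..t}\<close>, where the formula reduces to an empty inner sum and gives
  \<open>0\<close> as well.\<close>

lemma Psi_eq:
  assumes "K \<subseteq> {1..n + 1}"
  shows "Psi n a K = tableau_min a K - (\<Sum>k\<in>K. \<Sum>i=1..k - 1. a i k)"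
proof (cases "K \<in> subsets_proper n")
  case True
  have "finite K"
    using assms finite_subset by blast
  then have "(\<Sum>j=1..card K. \<Sum>i=1..nth_elem K j - 1. a i (nth_elem K j)) = (\<Sum>k\<in>K. \<Sum>i=1..k - 1. a i k)"
    using sum_nth_elem[of K "\<lambda>k. \<Sum>i=1..k - 1. a i k"] by simp
  with True show ?thesis
    by (simp add: Psi_def tableau_min_def tableau_sums_def)
next
  case False
  then have "K = {} \<or> K = {1..n + 1}"
    using assms by (auto simp: subsets_proper_def)
  moreover have "{} = {1..0::nat}"
    by simp
  ultimately obtain t where "K = {1..t}"
    by metis
  then show ?thesis
    using False Psi_interval_aux[of 1 a t] by (simp add: Psi_def)
qed

lemma Psi_interval:
  assumes "1 \<le> s" "t \<le> n + 1"
  shows "Psi n a {s..t} = - (\<Sum>j=s..t. \<Sum>i=1..<s. a i j)"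
  using assms Psi_interval_aux[OF assms(1)] by (subst Psi_eq) auto

text \<open>Passing from \<open>{s..j - 1}\<close> to \<open>{s..j}\<close> subtracts the entries of
  column \<open>j\<close> in the rows before \<open>s\<close>; comparing \<open>s = i\<close> with
  \<open>s = i + 1\<close> isolates one entry.\<close>

lemma Psi_entry:
  assumes "1 \<le> i" "i < j" "j \<le> n + 1"
  shows "defect (Psi n a) {i<..<j} i j = a i j"
proof -
  obtain m where m: "j = Suc m"
    using assms by (cases j) auto
  have "Psi n a {s..Suc m} = Psi n a {s..m} - (\<Sum>i=1..<s. a i j)" if "1 \<le> s" "s \<le> Suc m" for s
    using that assms m by (simp add: Psi_interval)
  from this[of i] this[of "i + 1"] show ?thesis
    using assms m by (simp add: defect_interval)
qed

lemma trop_pluecker_Psi: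
  assumes "a \<in> B_set n"
  shows "trop_pluecker (n + 1) (Psi n a)"
  unfolding trop_pluecker_def
proof (intro allI impI)
  fix K i j k
  assume *: "K \<subseteq> {1..n + 1}" "i \<notin> K" "j \<notin> K" "k \<notin> K" "1 \<le> i" "i < j" "j < k" "k \<le> n + 1"
  then have "finite K"
    using finite_subset by blast
  \<comment> \<open>The column sums contribute \<open>f i + f j + f k\<close> plus twice
    \<open>sum f K\<close> to each of the three sums in (iii), so they cancel.\<close>
  define f where "f k = (\<Sum>i=1..k - 1. a i k)" for k
  have 1: "Psi n a (insert x K) = tableau_min a (insert x K) - (f x + sum f K)"
    if "x \<in> {i, j, k}" for x
    using that * \<open>finite K\<close> unfolding f_def by (subst Psi_eq) auto
  have 2: "Psi n a (insert x (insert y K)) = tableau_min a (insert x (insert y K)) - (f x + f y + sum f K)"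
    if "x \<in> {i, j, k}" "y \<in> {i, j, k}" "x \<noteq> y" for x y
    using that * \<open>finite K\<close> unfolding f_def by (subst Psi_eq) auto
  show "Psi n a (insert i (insert k K)) + Psi n a (insert j K)
      = min (Psi n a (insert i (insert j K)) + Psi n a (insert k K))
          (Psi n a (insert j (insert k K)) + Psi n a (insert i K))"
    using tableau_min_tropical_pluecker[of K i j k a] B_set_nonneg[OF assms] * \<open>finite K\<close>
    by (simp add: 1 2 min_def)
qed

lemma Psi_in_BZ_set:
  assumes "a \<in> B_set n"
  shows "Psi n a \<in> BZ_set n"
  unfolding BZ_set_iff
proof (intro conjI allI impI ballI)
  show "Psi n a K = 0" if "K \<notin> subsets_proper n" for K
    using that by (simp add: Psi_def)
  show "Psi n a {1..i} = 0" if "i \<in> {1..n}" for i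
    using that by (simp add: Psi_interval)
  show "trop_pluecker (n + 1) (Psi n a)"
    by (rule trop_pluecker_Psi[OF assms])
qed (use assms in \<open>simp_all add: Psi_entry B_set_nonneg\<close>)

section \<open>Bijectivity and weights\<close>

lemma inj_on_Psi: "inj_on (Psi n) (B_set n)"
proof
  fix a b assume *: "a \<in> B_set n" "b \<in> B_set n" "Psi n a = Psi n b"
  show "a = b"
  proof (intro ext)
    fix i j
    show "a i j = b i j"
      using * Psi_entry[of i j n a] Psi_entry[of i j n b]
      by (cases "(i, j) \<in> Pairs n") (auto simp: B_set_def Pairs_def)
  qed
qed

text \<open>The preimage has the interval defects as entries. Their column sums telescope and
  recover the interval values, which determine the datum by \<open>BZ_set_eqI\<close>.\<close>

lemma Psi_surj:
  assumes M: "M \<in> BZ_set n"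
  shows "M \<in> Psi n ` B_set n"
proof
  define a where "a i j = (if (i, j) \<in> Pairs n then defect M {i<..<j} i j else 0)" for i j
  show a: "a \<in> B_set n"
    using M by (auto simp: B_set_def a_def BZ_set_iff Pairs_def)
  show "M = Psi n a"
  proof (rule BZ_set_eqI[OF M Psi_in_BZ_set[OF a]])
    fix s t :: nat assume st: "1 \<le> s" "t \<le> n + 1"
    \<comment> \<open>Telescoping in \<open>s\<close>; at \<open>s = 1\<close> both values are
      \<open>0\<close> by \<open>BZ_set_initial\<close>.\<close>
    have column: "(\<Sum>i=1..<s. a i j) = M {s..j - 1} - M {s..j}" if "s \<le> j" "j \<le> n + 1" for j
      using st(1) that(1)
    proof (induction s rule: dec_induct)
      case base
      then show ?case
        using BZ_set_initial[OF M, of "j - 1"] BZ_set_initial[OF M, of j] that by simp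
    next
      case (step s)
      then show ?case
        using that by (simp add: a_def Pairs_def defect_interval)
    qed
    have "M {s..t} = - (\<Sum>j=s..t. \<Sum>i=1..<s. a i j)" if "s \<le> t"
      using that st(2)
    proof (induction t rule: dec_induct)
      case base
      then show ?case
        using column[of s] st BZ_set_full[OF M] by simp
    next
      case (step t)
      then show ?case
        using column[of "Suc t"] by simp
    qed
    then show "M {s..t} = Psi n a {s..t}"
      using st BZ_set_full[OF M] Psi_interval[of s t n a] by (cases "s \<le> t") auto
  qed
qed

lemma bij_betw_Psi: "bij_betw (Psi n) (B_set n) (BZ_set n)"
  unfolding bij_betw_def using inj_on_Psi Psi_in_BZ_set Psi_surj by blast

lemma B_wt_Psi: "BZ_wt n (Psi n a) = B_wt n a"
proof -
  have "Psi n a {i + 1..n + 1} = - (\<Sum>k=1..i. \<Sum>l=i + 1..n + 1. a k l)" for i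
  proof -
    have "{1..<i + 1} = {1..i}"
      by auto
    then have "Psi n a {i + 1..n + 1} = - (\<Sum>l=i + 1..n + 1. \<Sum>k=1..i. a k l)"
      by (subst Psi_interval) simp_all
    then show ?thesis
      by (subst sum.swap)
  qed
  then show ?thesis
    unfolding BZ_wt_def B_wt_def by simp
qed

section \<open>The crystal operators\<close>

text \<open>The number \<open>E\<^sub>l\<close>: for \<open>i + 1 \<le> l\<close> it is
  \<open>defect M {i + 2..l} i (i + 1)\<close>, and for \<open>l = n + 1\<close> it is
  \<open>BZ_eps n i M\<close>.\<close>

definition strip :: "bz \<Rightarrow> nat \<Rightarrow> nat \<Rightarrow> int" where
  "strip M i l = M {i..l} + M {i + 2..l} - M {i + 1..l} - M (insert i {i + 2..l})"

lemma strip_base: "strip M i (i + 1) = defect M {i<..<i + 1} i (i + 1)"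
proof -
  have "{i + 2..i + 1} = {}" "{i..i} = {i}" "{i + 1..i + 1 - 1} = {}" "i + 1 - 1 = i"
    by auto
  then show ?thesis
    by (simp add: strip_def defect_interval)
qed

text \<open>Condition (iii) at \<open>i < i + 1 < l + 1\<close> over \<open>{i + 2..l}\<close>
  expresses the value at \<open>insert i {i + 2..l + 1}\<close> through a minimum, which becomes the
  \<open>max\<close> after the change of sign.\<close>

lemma strip_step:
  assumes "trop_pluecker N M" "1 \<le> i" "i + 1 \<le> l" "l + 1 \<le> N"
  shows "strip M i (l + 1) = defect M {i<..<l + 1} i (l + 1)
    + max 0 (strip M i l - defect M {i + 1<..<l + 1} (i + 1) (l + 1))"
proof -
  let ?L = "{i + 2..l}"
  have "?L \<subseteq> {1..N}" "i \<notin> ?L" "i + 1 \<notin> ?L" "l + 1 \<notin> ?L"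
    using assms by auto
  moreover have "i < i + 1" "i + 1 < l + 1"
    using assms by auto
  ultimately have *: "M (insert i (insert (l + 1) ?L)) + M (insert (i + 1) ?L)
      = min (M (insert i (insert (i + 1) ?L)) + M (insert (l + 1) ?L))
            (M (insert (i + 1) (insert (l + 1) ?L)) + M (insert i ?L))"
    using assms by (intro trop_plueckerD[OF assms(1)])
  have eqs: "insert (i + 1) ?L = {i + 1..l}" "insert (l + 1) ?L = {i + 2..l + 1}"
    "insert (i + 1) {i + 2..l + 1} = {i + 1..l + 1}" "insert i {i + 1..l} = {i..l}"
    using assms by auto
  have "M (insert i {i + 2..l + 1}) + M {i + 1..l}
      = min (M {i..l} + M {i + 2..l + 1}) (M {i + 1..l + 1} + M (insert i ?L))"
    using * unfolding eqs .
  moreover have "defect M {i<..<l + 1} i (l + 1) = M {i..l + 1} + M {i + 1..l} - M {i..l} - M {i + 1..l + 1}"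
    "defect M {i + 1<..<l + 1} (i + 1) (l + 1)
      = M {i + 1..l + 1} + M {i + 2..l} - M {i + 1..l} - M {i + 2..l + 1}"
    using assms by (simp_all add: defect_interval)
  ultimately show ?thesis
    unfolding strip_def by linarith
qed

lemma A_star_step:
  assumes "l < n"
  shows "A_star n i l a = A_star n i (l + 1) a + a i (l + 1) - a (i + 1) (l + 2)"
proof -
  have "{l + 1..n + 1} = insert (l + 1) {l + 2..n + 1}"
    using assms by auto
  then show ?thesis
    unfolding A_star_def by simp
qed

lemma A_star_last:
  assumes "a \<in> B_set n"
  shows "A_star n i n a = a i (n + 1)"
  using assms by (simp add: A_star_def B_set_def Pairs_def)

text \<open>A running maximum solves the recursion of \<open>strip_step\<close>, since the
  increments of \<open>A_star\<close> turn \<open>max 0\<close> into a maximum with one more term.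
  At \<open>l = n\<close> the first two terms cancel and \<open>B_eps\<close> remains.\<close>

lemma strip_Psi:
  assumes a: "a \<in> B_set n" and "1 \<le> i" "i \<le> l" "l \<le> n"
  shows "strip (Psi n a) i (l + 1)
    = a i (l + 1) - A_star n i l a + Max ((\<lambda>p. A_star n i p a) ` {i..l})"
  using assms(3,4)
proof (induction l rule: dec_induct)
  case base
  have "strip (Psi n a) i (i + 1) = a i (i + 1)"
    unfolding strip_base using assms by (intro Psi_entry) auto
  then show ?case
    by simp
next
  case (step l)
  have "strip (Psi n a) i (l + 1 + 1) = a i (l + 1 + 1)
      + max 0 (strip (Psi n a) i (l + 1) - a (i + 1) (l + 1 + 1))"
    using strip_step[OF trop_pluecker_Psi[OF a], of i "l + 1"] step assms
      Psi_entry[of i "l + 1 + 1" n a] Psi_entry[of "i + 1" "l + 1 + 1" n a] by simp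
  moreover have "{i..Suc l} = insert (Suc l) {i..l}"
    using step by auto
  then have "Max ((\<lambda>p. A_star n i p a) ` {i..Suc l})
      = max (A_star n i (Suc l) a) (Max ((\<lambda>p. A_star n i p a) ` {i..l}))"
    using step by simp
  ultimately show ?case
    using step A_star_step[of l n i a] by (simp add: max_def)
qed

lemma BZ_eps_Psi:
  assumes "a \<in> B_set n" "i \<in> {1..n}"
  shows "BZ_eps n i (Psi n a) = B_eps n i a"
  using strip_Psi[OF assms(1), of i n] assms A_star_last[OF assms(1)]
  by (simp add: BZ_eps_def strip_def B_eps_def)

section \<open>The elementary move on families\<close>

text \<open>The lowering operator is the case \<open>q = l_f n i a\<close>, \<open>d = 1\<close>,
  the raising operator the case \<open>q = l_e n i a\<close>, \<open>d = - 1\<close>.\<close>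

definition bump :: "nat \<Rightarrow> nat \<Rightarrow> nat \<Rightarrow> int \<Rightarrow> family \<Rightarrow> family" where
  "bump n i q d a = add_entry n (i + 1, q + 1) (- d) (add_entry n (i, q + 1) d a)"

text \<open>The guard \<open>i < q\<close> reflects that \<open>(i + 1, q + 1)\<close> lies off
  \<open>\<Pi>\<close> for \<open>q = i\<close>.\<close>

lemma bump_apply:
  assumes "1 \<le> i" "i \<le> q" "q \<le> n"
  shows "bump n i q d a x y = a x y + (if x = i then if y = q + 1 then d else 0 else 0)
    - (if x = i + 1 then if y = q + 1 then if i < q then d else 0 else 0 else 0)"
  using assms by (auto simp: bump_def add_entry_def Pairs_def)

lemma bump_in_B_set:
  assumes "a \<in> B_set n" "1 \<le> i" "i \<le> q" "q \<le> n"
    and "0 \<le> a i (q + 1) + d" "i < q \<Longrightarrow> 0 \<le> a (i + 1) (q + 1) - d"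
  shows "bump n i q d a \<in> B_set n"
  unfolding B_set_def mem_Collect_eq
proof (intro conjI allI impI)
  fix x y
  show "0 \<le> bump n i q d a x y" if "(x, y) \<in> Pairs n"
    using assms B_set_nonneg[OF assms(1), of x y] by (auto simp: bump_apply)
  show "bump n i q d a x y = 0" if "(x, y) \<notin> Pairs n"
    using assms that by (auto simp: bump_apply Pairs_def B_set_def)
qed

lemma bump_inverse:
  assumes "1 \<le> i" "i \<le> q" "q \<le> n"
  shows "bump n i q (- d) (bump n i q d a) = a"
  by (intro ext) (simp add: bump_apply[OF assms])

text \<open>The changed entries occur in the summands \<open>t = q + 1\<close> and
  \<open>t = q\<close>, each raising the sum by \<open>d\<close>; both are in range for
  \<open>p < q\<close>, only the first for \<open>p = q\<close>.\<close>

lemma A_star_bump: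
  assumes "1 \<le> i" "i \<le> q" "q \<le> n" "i \<le> p" "p \<le> n"
  shows "A_star n i p (bump n i q d a)
    = A_star n i p a + (if p < q then 2 * d else if p = q then d else 0)"
proof -
  have "A_star n i p (bump n i q d a) = (\<Sum>t=p + 1..n + 1. (a i t - a (i + 1) (t + 1))
      + ((if t = q + 1 then d else 0) + (if t = q then if i < q then d else 0 else 0)))"
    unfolding A_star_def by (intro sum.cong) (auto simp: bump_apply[OF assms(1-3)])
  also have "\<dots> = A_star n i p a + ((\<Sum>t=p + 1..n + 1. if t = q + 1 then d else 0)
      + (\<Sum>t=p + 1..n + 1. if t = q then if i < q then d else 0 else 0))"
    unfolding A_star_def by (simp only: sum.distrib)
  also have "(\<Sum>t=p + 1..n + 1. if t = q + 1 then d else 0) = (if p \<le> q then d else 0)"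
    using assms by (subst sum.delta) auto
  also have "(\<Sum>t=p + 1..n + 1. if t = q then if i < q then d else 0 else 0) = (if p < q then d else 0)"
    using assms by (subst sum.delta) auto
  finally show ?thesis
    by auto
qed

lemma Psi_interval_bump:
  assumes "1 \<le> i" "i \<le> q" "q \<le> n" "1 \<le> s" "t \<le> n + 1"
  shows "Psi n (bump n i q d a) {s..t} = Psi n a {s..t} - (if s = i + 1 \<and> q < t then d else 0)"
proof -
  have "(\<Sum>x=1..<s. bump n i q d a x j) = (\<Sum>x=1..<s. a x j)
      + (if j = q + 1 then if s = i + 1 \<or> i < s \<and> i = q then d else 0 else 0)" for j
  proof -
    have "(\<Sum>x=1..<s. bump n i q d a x j) = (\<Sum>x=1..<s. a x j)
      + (\<Sum>x=1..<s. if x = i then if j = q + 1 then d else 0 else 0)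
      - (\<Sum>x=1..<s. if x = i + 1 then if j = q + 1 then if i < q then d else 0 else 0 else 0)"
      by (simp only: bump_apply[OF assms(1-3)] sum.distrib sum_subtractf)
    then show ?thesis
      using assms by (simp only: sum.delta finite_atLeastLessThan) auto
  qed
  then have "(\<Sum>j=s..t. \<Sum>x=1..<s. bump n i q d a x j) = (\<Sum>j=s..t. \<Sum>x=1..<s. a x j)
      + (\<Sum>j=s..t. if j = q + 1 then if s = i + 1 \<or> i < s \<and> i = q then d else 0 else 0)"
    by (simp only: sum.distrib)
  \<comment> \<open>For \<open>q = i\<close> only the entry \<open>(i, i + 1)\<close> changes. Its
    column is in range only if \<open>s \<le> i + 1\<close>, which with \<open>i < s\<close> again
    gives \<open>s = i + 1\<close>.\<close>
  also have "(\<Sum>j=s..t. if j = q + 1 then if s = i + 1 \<or> i < s \<and> i = q then d else 0 else 0)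
      = (if s = i + 1 \<and> q < t then d else 0)"
    using assms by (subst sum.delta) auto
  finally show ?thesis
    using assms by (simp add: Psi_interval)
qed

lemma B_eps_attained:
  assumes "i \<le> n"
  shows "\<exists>l\<in>{i..n}. A_star n i l a = B_eps n i a"
    and "\<And>p. i \<le> p \<Longrightarrow> p \<le> n \<Longrightarrow> A_star n i p a \<le> B_eps n i a"
proof -
  let ?A = "(\<lambda>l. A_star n i l a) ` {i..n}"
  have "Max ?A \<in> ?A"
    using assms by (intro Max_in) auto
  then show "\<exists>l\<in>{i..n}. A_star n i l a = B_eps n i a"
    by (auto simp: B_eps_def)
  show "A_star n i p a \<le> B_eps n i a" if "i \<le> p" "p \<le> n" for p
    unfolding B_eps_def using that by (intro Max_ge) auto
qed

lemma l_f_iff: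
  assumes "i \<le> n"
  shows "l_f n i a = q \<longleftrightarrow> q \<in> {i..n} \<and> A_star n i q a = B_eps n i a
    \<and> (\<forall>p\<in>{i..<q}. A_star n i p a < B_eps n i a)"
proof -
  let ?S = "{l \<in> {i..n}. A_star n i l a = B_eps n i a}"
  have "finite ?S" "?S \<noteq> {}"
    using B_eps_attained(1)[OF assms, of a] by auto
  then have "l_f n i a = q \<longleftrightarrow> q \<in> ?S \<and> (\<forall>p\<in>?S. q \<le> p)"
    unfolding l_f_def by (rule Min_eq_iff)
  also have "\<dots> \<longleftrightarrow> q \<in> ?S \<and> (\<forall>p\<in>{i..<q}. A_star n i p a < B_eps n i a)"
  proof (intro conj_cong refl iffI ballI)
    fix p assume *: "\<forall>p\<in>?S. q \<le> p" "p \<in> {i..<q}" "q \<in> ?S"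
    then have p: "p \<in> {i..n}"
      by auto
    moreover have "A_star n i p a \<noteq> B_eps n i a"
      using *(1)[rule_format, of p] *(2) p by auto
    ultimately show "A_star n i p a < B_eps n i a"
      using B_eps_attained(2)[OF assms, of p a] by simp
  next
    fix p assume "\<forall>p\<in>{i..<q}. A_star n i p a < B_eps n i a" "p \<in> ?S"
    then have "p \<notin> {i..<q}" "p \<in> {i..n}"
      by force+
    then show "q \<le> p"
      by auto
  qed
  finally show ?thesis
    by auto
qed

lemma l_e_iff:
  assumes "i \<le> n"
  shows "l_e n i a = q \<longleftrightarrow> q \<in> {i..n} \<and> A_star n i q a = B_eps n i a
    \<and> (\<forall>p\<in>{q<..n}. A_star n i p a < B_eps n i a)"
proof -
  let ?S = "{l \<in> {i..n}. A_star n i l a = B_eps n i a}"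
  have "finite ?S" "?S \<noteq> {}"
    using B_eps_attained(1)[OF assms, of a] by auto
  then have "l_e n i a = q \<longleftrightarrow> q \<in> ?S \<and> (\<forall>p\<in>?S. p \<le> q)"
    unfolding l_e_def by (rule Max_eq_iff)
  also have "\<dots> \<longleftrightarrow> q \<in> ?S \<and> (\<forall>p\<in>{q<..n}. A_star n i p a < B_eps n i a)"
  proof (intro conj_cong refl iffI ballI)
    fix p assume *: "\<forall>p\<in>?S. p \<le> q" "p \<in> {q<..n}" "q \<in> ?S"
    then have p: "p \<in> {i..n}"
      by auto
    moreover have "A_star n i p a \<noteq> B_eps n i a"
      using *(1)[rule_format, of p] *(2) p by auto
    ultimately show "A_star n i p a < B_eps n i a"
      using B_eps_attained(2)[OF assms, of p a] by simp
  next
    fix p assume "\<forall>p\<in>{q<..n}. A_star n i p a < B_eps n i a" "p \<in> ?S"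
    then have "p \<notin> {q<..n}" "p \<in> {i..n}"
      by force+
    then show "p \<le> q"
      by auto
  qed
  finally show ?thesis
    by auto
qed

text \<open>By \<open>trop_pluecker_unique_nonstar\<close> it suffices to compare intervals not
  starting at \<open>i + 1\<close> and the sets \<open>insert i {i + 2..t}\<close>. For the latter,
  \<open>strip\<close> rises by one exactly for those \<open>t\<close> at which the value at
  \<open>{i + 1..t}\<close> falls by one.\<close>

lemma Psi_bump_nonstar:
  assumes a: "a \<in> B_set n" and i: "i \<in> {1..n}" and a': "bump n i (l_f n i a) 1 a \<in> B_set n"
    and "K \<subseteq> {1..n + 1}" "i \<in> K \<or> i + 1 \<notin> K"
  shows "Psi n (bump n i (l_f n i a) 1 a) K = Psi n a K"
proof -
  define q where "q = l_f n i a"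
  let ?b = "bump n i q 1 a"
  have q: "q \<in> {i..n}" "A_star n i q a = B_eps n i a" "\<forall>p\<in>{i..<q}. A_star n i p a < B_eps n i a"
    using l_f_iff[of i n a q] i by (auto simp: q_def)
  have iq: "1 \<le> i" "i \<le> q" "q \<le> n"
    using i q by auto
  have b: "?b \<in> B_set n"
    using a' by (simp add: q_def)
  have max_q: "Max ((\<lambda>p. A_star n i p c) ` {i..l}) = A_star n i q c"
    if "q \<le> l" "\<And>p. i \<le> p \<Longrightarrow> p \<le> l \<Longrightarrow> A_star n i p c \<le> A_star n i q c" for l c
    using that iq by (intro Max_eqI) auto
  have strip: "strip (Psi n ?b) i (l + 1) = strip (Psi n a) i (l + 1) + (if q \<le> l then 1 else 0)"
    if "i \<le> l" "l \<le> n" for l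
  proof (cases "q \<le> l")
    case True
    have le: "A_star n i p a \<le> A_star n i q a" if "i \<le> p" "p \<le> n" for p
      using B_eps_attained(2)[of i n p a] that q by auto
    \<comment> \<open>The values left of \<open>q\<close> gain \<open>2\<close>, the one at
      \<open>q\<close> only \<open>1\<close>; by minimality of \<open>l_f\<close> the former were
      strictly smaller, so \<open>q\<close> still attains the maximum.\<close>
    have le': "A_star n i p ?b \<le> A_star n i q ?b" if "i \<le> p" "p \<le> n" for p
      using le[of p] q(2) q(3)[rule_format, of p] that iq by (auto simp: A_star_bump[OF iq])
    have "Max ((\<lambda>p. A_star n i p a) ` {i..l}) = A_star n i q a"
      "Max ((\<lambda>p. A_star n i p ?b) ` {i..l}) = A_star n i q ?b"
      using that True by (intro max_q le le'; simp)+
    then show ?thesis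
      using True that strip_Psi[OF a iq(1), of l] strip_Psi[OF b iq(1), of l]
        A_star_bump[OF iq, of l 1 a] A_star_bump[OF iq, of q 1 a] bump_apply[OF iq, of 1 a i "l + 1"] iq
      by auto
  next
    case False
    \<comment> \<open>For \<open>l < q\<close> the maximum and \<open>A_star n i l\<close> both gain
      \<open>2\<close>, which cancels.\<close>
    have "(\<lambda>p. A_star n i p ?b) ` {i..l} = (\<lambda>x. x + 2) ` (\<lambda>p. A_star n i p a) ` {i..l}"
      unfolding image_image using False that iq by (intro image_cong) (auto simp: A_star_bump)
    moreover have "Max ((\<lambda>x. x + 2) ` (\<lambda>p. A_star n i p a) ` {i..l}) = Max ((\<lambda>p. A_star n i p a) ` {i..l}) + 2"
      using that by (intro mono_Max_commute[symmetric]) (auto simp: mono_def)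
    ultimately show ?thesis
      using False that strip_Psi[OF a iq(1), of l] strip_Psi[OF b iq(1), of l]
        A_star_bump[OF iq, of l 1 a] bump_apply[OF iq, of 1 a i "l + 1"] iq
      by auto
  qed
  have intervals: "Psi n ?b {s..t} = Psi n a {s..t} - (if s = i + 1 \<and> q < t then 1 else 0)"
    if "1 \<le> s" "t \<le> n + 1" for s t
    using Psi_interval_bump[OF iq that] .
  show ?thesis
    unfolding q_def[symmetric]
  proof (rule trop_pluecker_unique_nonstar[where N = "n + 1" and i = i])
    show "trop_pluecker (n + 1) (Psi n ?b)" "trop_pluecker (n + 1) (Psi n a)"
      by (rule trop_pluecker_Psi[OF b], rule trop_pluecker_Psi[OF a])
    show "Psi n ?b (insert i {i + 2..t}) = Psi n a (insert i {i + 2..t})"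
      if "i + 1 \<le> t" "t \<le> n + 1" for t
    proof -
      have "strip (Psi n ?b) i t = strip (Psi n a) i t + (if q < t then 1 else 0)"
        using strip[of "t - 1"] that by (auto simp: Suc_le_eq less_Suc_eq_le)
      then show ?thesis
        using that iq unfolding strip_def by (simp add: intervals)
    qed
  qed (use assms iq intervals in auto)
qed

section \<open>Matching the operators\<close>

text \<open>Two data meeting the description agree off the star sets, hence by
  \<open>star_intervals_agree\<close> on the intervals \<open>{i + 1..t}\<close>; agreeing on all
  intervals, they coincide.\<close>

lemma BZ_shift_eqI:
  assumes "M \<in> BZ_set n" "M' \<in> BZ_set n" "i \<in> {1..n}"
    and "M' {i + 1..n + 1} = M {i + 1..n + 1} + d"
    and "\<And>K. K \<in> subsets_proper n - subsets_star n i \<Longrightarrow> M' K = M K"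
  shows "BZ_shift n i d M = M'"
  unfolding BZ_shift_def
proof (rule the_equality)
  fix M'' assume M'': "M'' \<in> BZ_set n \<and> M'' {i + 1..n + 1} = M {i + 1..n + 1} + d \<and>
    (\<forall>K\<in>subsets_proper n - subsets_star n i. M'' K = M K)"
  have P: "trop_pluecker (n + 1) M''" "trop_pluecker (n + 1) M'"
    using M'' assms by (auto simp: BZ_set_iff)
  have nonstar: "M'' K = M' K" if "i \<in> K \<or> i + 1 \<notin> K" for K
  proof (cases "K \<in> subsets_proper n")
    case True
    then show ?thesis
      using M'' assms(5) that by (auto simp: subsets_star_def)
  next
    case False
    then show ?thesis
      using M'' assms(2) by (simp add: BZ_set_iff)
  qed
  show "M'' = M'"
  proof (rule BZ_set_eqI)
    fix s t :: nat assume st: "1 \<le> s" "t \<le> n + 1"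
    show "M'' {s..t} = M' {s..t}"
    proof (cases "s = i + 1 \<and> i + 1 \<le> t")
      case True
      have "M'' {i + 1..t} = M' {i + 1..t}"
      proof (rule star_intervals_agree[OF P])
        show "M'' K = M' K" if "i \<in> K \<or> i + 1 \<notin> K" for K
          by (rule nonstar[OF that])
        show "M'' {i + 1..n + 1} = M' {i + 1..n + 1}"
          using M'' assms(4) by simp
      qed (use True st assms(3) in auto)
      with True show ?thesis
        by simp
    next
      case False
      then show ?thesis
        by (intro nonstar) auto
    qed
  qed (use M'' assms in auto)
qed (use assms in auto)

text \<open>For \<open>i < q\<close>, minimality of \<open>l_f\<close> gives
  \<open>A_star n i (q - 1) a < A_star n i q a\<close>, which forces
  \<open>a (i + 1) (q + 1) > a i q\<close>; so the decrement keeps this entry nonnegative.\<close>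

lemma bump_l_f_in_B_set:
  assumes a: "a \<in> B_set n" and i: "i \<in> {1..n}"
  shows "bump n i (l_f n i a) 1 a \<in> B_set n"
proof -
  define q where "q = l_f n i a"
  have q: "q \<in> {i..n}" "A_star n i q a = B_eps n i a" "\<forall>p\<in>{i..<q}. A_star n i p a < B_eps n i a"
    using l_f_iff[of i n a q] i by (auto simp: q_def)
  then have iq: "1 \<le> i" "i \<le> q" "q \<le> n"
    using i by auto
  have "0 < a (i + 1) (q + 1)" if "i < q"
  proof -
    have "A_star n i (q - 1) a < A_star n i q a"
      using q that by auto
    moreover have "A_star n i (q - 1) a = A_star n i q a + a i q - a (i + 1) (q + 1)"
      using A_star_step[of "q - 1" n i a] that iq by simp
    ultimately show ?thesis
      using B_set_nonneg[OF a, of i q] by linarith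
  qed
  then show ?thesis
    using a iq B_set_nonneg[OF a, of i "q + 1"] unfolding q_def[symmetric]
    by (intro bump_in_B_set) auto
qed

text \<open>The comparison of a family with its lowered version is symmetric, so it identifies the
  shifts in both directions.\<close>

lemma BZ_shift_Psi:
  assumes a: "a \<in> B_set n" and i: "i \<in> {1..n}"
  shows "BZ_shift n i (- 1) (Psi n a) = Psi n (bump n i (l_f n i a) 1 a)"
    and "BZ_shift n i 1 (Psi n (bump n i (l_f n i a) 1 a)) = Psi n a"
proof -
  let ?b = "bump n i (l_f n i a) 1 a"
  have b: "?b \<in> B_set n"
    using bump_l_f_in_B_set[OF a i] .
  have "l_f n i a \<in> {i..n}"
    using l_f_iff[of i n a "l_f n i a"] i by auto
  then have top: "Psi n ?b {i + 1..n + 1} = Psi n a {i + 1..n + 1} - 1"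
    using i by (subst Psi_interval_bump) auto
  have nonstar: "Psi n ?b K = Psi n a K" if "K \<in> subsets_proper n - subsets_star n i" for K
    using that by (intro Psi_bump_nonstar[OF a i b]) (auto simp: subsets_star_def subsets_proper_def)
  show "BZ_shift n i (- 1) (Psi n a) = Psi n ?b"
    using a b i top nonstar by (intro BZ_shift_eqI Psi_in_BZ_set) auto
  show "BZ_shift n i 1 (Psi n ?b) = Psi n a"
    using a b i top nonstar by (intro BZ_shift_eqI Psi_in_BZ_set) auto
qed

text \<open>Beyond \<open>l_e\<close> the values of \<open>A_star\<close> were strictly below the
  maximum; at \<open>l_e\<close> the value falls by \<open>1\<close> and before it by
  \<open>2\<close>. The new maximum is smaller by one and first attained at \<open>l_e\<close>, so
  lowering undoes raising.\<close>

lemma bump_l_e: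
  assumes a: "a \<in> B_set n" and i: "i \<in> {1..n}" and "B_eps n i a \<noteq> 0"
  shows "bump n i (l_e n i a) (- 1) a \<in> B_set n"
    and "l_f n i (bump n i (l_e n i a) (- 1) a) = l_e n i a"
proof -
  define q where "q = l_e n i a"
  let ?b = "bump n i q (- 1) a"
  have q: "q \<in> {i..n}" "A_star n i q a = B_eps n i a" "\<forall>p\<in>{q<..n}. A_star n i p a < B_eps n i a"
    using l_e_iff[of i n a q] i by (auto simp: q_def)
  then have iq: "1 \<le> i" "i \<le> q" "q \<le> n"
    using i by auto
  \<comment> \<open>For \<open>q = n\<close> the entry is \<open>B_eps n i a\<close> itself;
    otherwise maximality of \<open>l_e\<close> makes it exceed
    \<open>a (i + 1) (q + 2)\<close>.\<close>
  have "0 < a i (q + 1)"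
  proof (cases "q = n")
    case True
    then show ?thesis
      using q A_star_last[OF a, of i] B_set_nonneg[OF a, of i "n + 1"] assms(3) by auto
  next
    case False
    then have "A_star n i (q + 1) a < A_star n i q a"
      using q by auto
    then show ?thesis
      using A_star_step[of q n i a] B_set_nonneg[OF a, of "i + 1" "q + 2"] False iq by simp
  qed
  then show "bump n i (l_e n i a) (- 1) a \<in> B_set n"
    using a iq B_set_nonneg[OF a, of "i + 1" "q + 1"] unfolding q_def[symmetric]
    by (intro bump_in_B_set) auto
  have le: "A_star n i p a \<le> B_eps n i a" if "p \<in> {i..n}" for p
    using B_eps_attained(2)[of i n p a] that by auto
  have A: "A_star n i p ?b \<le> B_eps n i a - 1" if "p \<in> {i..n}" for p
    using le[OF that] q(2) q(3)[rule_format, of p] that by (auto simp: A_star_bump[OF iq])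
  have "A_star n i q ?b = B_eps n i a - 1"
    using q(2) iq by (simp add: A_star_bump)
  then have "B_eps n i ?b = B_eps n i a - 1"
    unfolding B_eps_def[of n i ?b] using A q(1) by (intro Max_eqI) (auto intro: rev_image_eqI)
  moreover have "A_star n i p ?b < B_eps n i a - 1" if "p \<in> {i..<q}" for p
    using le[of p] that iq by (auto simp: A_star_bump)
  ultimately show "l_f n i (bump n i (l_e n i a) (- 1) a) = l_e n i a"
    using q(1) \<open>A_star n i q ?b = B_eps n i a - 1\<close> i unfolding q_def[symmetric]
    by (subst l_f_iff) auto
qed

theorem theorem5p6p3:
  fixes n :: nat
  assumes "n \<ge> 1"
  shows "crystal_iso {1..n} (B_crystal n) (BZ_crystal n) (Psi n)"
proof -
  have f: "B_f n i a = Some (bump n i (l_f n i a) 1 a)" for i a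
    by (simp add: B_f_def bump_def)
  have e: "B_e n i a = (if B_eps n i a = 0 then None else Some (bump n i (l_e n i a) (- 1) a))" for i a
    by (simp add: B_e_def bump_def)
  have f_Psi: "BZ_f n i (Psi n a) = map_option (Psi n) (B_f n i a)"
    if "a \<in> B_set n" "i \<in> {1..n}" for i a
    using BZ_shift_Psi(1)[OF that] by (simp add: BZ_f_def f)
  have e_Psi: "BZ_e n i (Psi n a) = map_option (Psi n) (B_e n i a)"
    if "a \<in> B_set n" "i \<in> {1..n}" for i a
  proof (cases "B_eps n i a = 0")
    case False
    \<comment> \<open>Lowering \<open>b\<close> returns \<open>a\<close>, so the raising operator at
      \<open>Psi n a\<close> is the second shift of \<open>BZ_shift_Psi\<close> taken at
      \<open>b\<close>.\<close>
    define b where "b = bump n i (l_e n i a) (- 1) a"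
    have b: "b \<in> B_set n" "l_f n i b = l_e n i a"
      using bump_l_e[OF that False] by (simp_all add: b_def)
    have "l_e n i a \<in> {i..n}"
      using l_e_iff[of i n a "l_e n i a"] that by auto
    then have "bump n i (l_f n i b) 1 b = a"
      using bump_inverse[of i "l_e n i a" n "- 1" a] that unfolding b(2) b_def[symmetric] by simp
    then have "BZ_shift n i 1 (Psi n a) = Psi n b"
      using BZ_shift_Psi(2)[OF b(1) that(2)] by simp
    then show ?thesis
      using False that by (simp add: BZ_e_def e BZ_eps_Psi b_def)
  qed (use that in \<open>simp add: BZ_e_def e BZ_eps_Psi\<close>)
  have B_closed: "cr_ops_closed {1..n} (B_crystal n)"
    using bump_l_f_in_B_set bump_l_e(1)
    by (auto simp: cr_ops_closed_def B_crystal_def f e)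
  moreover have "cr_ops_closed {1..n} (BZ_crystal n)"
    unfolding cr_ops_closed_def
  proof (intro ballI)
    fix i M assume i: "i \<in> {1..n}" and "M \<in> cr_set (BZ_crystal n)"
    then obtain a where a: "a \<in> B_set n" "M = Psi n a"
      using Psi_surj by (auto simp: BZ_crystal_def)
    have "B_e n i a \<in> insert None (Some ` B_set n)" "B_f n i a \<in> insert None (Some ` B_set n)"
      using B_closed i a by (auto simp: cr_ops_closed_def B_crystal_def)
    then show "cr_e (BZ_crystal n) i M \<in> insert None (Some ` cr_set (BZ_crystal n)) \<and>
        cr_f (BZ_crystal n) i M \<in> insert None (Some ` cr_set (BZ_crystal n))"
      using a i Psi_in_BZ_set by (auto simp: BZ_crystal_def e_Psi f_Psi)
  qed
  ultimately show ?thesis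
    unfolding crystal_iso_def using bij_betw_Psi
    by (simp add: B_crystal_def BZ_crystal_def B_wt_Psi BZ_eps_Psi e_Psi f_Psi B_phi_def BZ_phi_def)
qed

end
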